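(* Let $q>1$ be an integer, $G=(\mathbb{Z}/q\mathbb{Z})^\times$, let $s>1$ be a real number and $P\ge 2$ a real parameter. With the vectors $V_s(t)$, $\Gamma_s(t)$ and matrices $M_1^{-1}$, $N_d$ defined in the context, for any integer $r\ge 2$ we have $$\biggl\| V_s(1)-\sum_{0\le v\le r-1}(-1)^v\sum_{d_1\cdots d_v\le 2^r}\frac{N_{d_1}}{d_1}\cdots\frac{N_{d_v}}{d_v}\,M_1^{-1}\,\Gamma_s(d_1\cdots d_v)\biggr\|\le \frac12\Bigl(1+\frac{r-1}{|G^\sharp|}\Bigr)\Bigl(\frac{|G^\sharp|\,d(\exp G)}{2}\Bigr)^{r-1}\frac{1+P/(s2^r-1)}{P^{s2^r}},$$ where in the inner sum $(d_1,\ldots,d_v)$ ranges over all $v$-tuples of divisors of $\exp G$ that are different from $1$ and satisfy $d_1\cdots d_v\le 2^r$; when $v=0$ the inner sum is the single term $M_1^{-1}\Gamma_s(1)$.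
   Context: $G=(\mathbb{Z}/q\mathbb{Z})^\times$; $\exp G$ is the exponent of $G$ (maximal order of an element); $d(n)$ is the number of positive divisors of $n$; $\mu$ is the Möbius function. $\mathscr{G}$ is the set of cyclic subgroups of $G$. A lattice-invariant class is a subset $\mathcal{A}\subset G$ which is the set of all generators of some cyclic subgroup $K$ of $G$; $G^\sharp$ is the set of lattice-invariant classes. $\mathcal{A}\mapsto\langle\mathcal{A}\rangle$ (the subgroup generated by $\mathcal{A}$) is a bijection $G^\sharp\to\mathscr{G}$, through which vectors and matrices indexed by $G^\sharp$ or by $\mathscr{G}$ are identified. For $\mathcal{A}\subset G$ and real $f>1$: $\zeta_P(f;q,\mathcal{A})=\prod_{p\ge P,\ p \bmod q\,\in\mathcal{A}}(1-p^{-f})^{-1}$ (product over primes). For a character $\chi$ of $G$, viewed as a Dirichlet character modulo $q$ (zero at integers not coprime to $q$), $L_P(f,\chi)=\prod_{p\ge P}(1-\chi(p)p^{-f})^{-1}$ (product over primes). For a subgroup $G_0$ of $G$, $G_0^\perp$ is the group of characters of $G$ taking the value $1$ on $G_0$. For a positive integer $t$: $\gamma_s(G_0,t)=\log\prod_{\chi\in G_0^\perp}L_P(ts,\chi)$ (the logarithm of a positive real number); $\Gamma_s(t)=(\gamma_s(G_0,t))_{G_0\in\mathscr{G}}$; $V_s(t)=(\log\zeta_P(ts;q,\mathcal{A}))_{\mathcal{A}\in G^\sharp}$. $M_1^{-1}$ is the square matrix with rows indexed by $\mathcal{A}\in G^\sharp$ and columns by $K\in\mathscr{G}$ whose entry at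 $(\mathcal{A},K)$ is $\mu(|\langle\mathcal{A}\rangle/K|)/|G/K|$ if $K\subset\langle\mathcal{A}\rangle$, and $0$ otherwise. For each divisor $d>1$ of $\exp G$, $N_d$ is the square matrix with rows and columns indexed by $\mathscr{G}$ whose entry at $(B_0,B_1)$ is $\sum_{K\subset B_0,\ |KB_1/K|=d}\mu(|B_0/K|)$, the sum being over subgroups $K$ of $B_0$. For a vector $W=(W_i)$, $\|W\|=\max_i|W_i|$. *)

theory Defs
  imports
    "HOL-Analysis.Analysis"
    "HOL-Algebra.Elementary_Groups"
    "HOL-Number_Theory.Number_Theory"
    "HOL-Computational_Algebra.Squarefree"
begin

text \<open>
  Vectors and matrices with entries indexed by finite sets of subsets of a group are plain
  functions; the index set appears wherever a sum or a maximum over it is taken.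
\<close>

definition moebius_mu :: "nat \<Rightarrow> int" where
  "moebius_mu n = (if squarefree n then (- 1) ^ card (prime_factors n) else 0)"

definition unit_group :: "nat \<Rightarrow> int monoid" where
  "unit_group q = units_of (residue_ring (int q))"

definition group_exp :: "('a, 'b) monoid_scheme \<Rightarrow> nat" where
  "group_exp G = Max (group.ord G ` carrier G)"

definition quot_order :: "('a, 'b) monoid_scheme \<Rightarrow> 'a set \<Rightarrow> 'a set \<Rightarrow> nat" where
  "quot_order G H K = order (G\<lparr>carrier := H\<rparr> Mod K)"

definition cyclic_subgroups :: "'a monoid \<Rightarrow> 'a set set" where
  "cyclic_subgroups G = {K. subgroup K G \<and> cyclic_group (G\<lparr>carrier := K\<rparr>)}"

definition lattice_classes :: "'a monoid \<Rightarrow> 'a set set" where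
  "lattice_classes G =
     {A. \<exists>K\<in>cyclic_subgroups G. A = {g \<in> K. generate G {g} = K}}"

definition complex_units :: "complex monoid" where
  "complex_units = \<lparr>carrier = - {0}, monoid.mult = (*), one = 1\<rparr>"

text \<open>
  Restricting to extensional functions makes two characters with the same values on the group
  equal, so that a product over a set of characters counts each of them once.
\<close>

definition characters :: "'a monoid \<Rightarrow> ('a \<Rightarrow> complex) set" where
  "characters G = hom G complex_units \<inter> extensional (carrier G)"

definition annihilator :: "'a monoid \<Rightarrow> 'a set \<Rightarrow> ('a \<Rightarrow> complex) set" where
  "annihilator G H = {\<psi> \<in> characters G. \<forall>g\<in>H. \<psi> g = 1}"

definition dirichlet_char :: "nat \<Rightarrow> (int \<Rightarrow> complex) \<Rightarrow> nat \<Rightarrow> complex" where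
  "dirichlet_char q \<psi> n = (if coprime n q then \<psi> (int n mod int q) else 0)"

text \<open>
  The Euler products run over all naturals, with factor 1 at those that are not
  primes of the required kind.
\<close>

definition zeta_P :: "real \<Rightarrow> nat \<Rightarrow> real \<Rightarrow> int set \<Rightarrow> real" where
  "zeta_P P q f A =
     (\<Prod>p. if prime p \<and> P \<le> real p \<and> int p mod int q \<in> A
           then inverse (1 - real p powr (- f)) else 1)"

definition L_P :: "real \<Rightarrow> nat \<Rightarrow> real \<Rightarrow> (int \<Rightarrow> complex) \<Rightarrow> complex" where
  "L_P P q f \<psi> =
     (\<Prod>p. if prime p \<and> P \<le> real p
           then inverse (1 - dirichlet_char q \<psi> p * of_real (real p powr (- f))) else 1)"

text \<open>
  The set of characters trivial on a subgroup is closed under complex conjugation,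
  so the product below is a real number (and positive); \<^const>\<open>Re\<close> only changes its type.
\<close>

definition Gamma_vec :: "real \<Rightarrow> nat \<Rightarrow> real \<Rightarrow> nat \<Rightarrow> int set \<Rightarrow> real" where
  "Gamma_vec P q s t H =
     ln (Re (\<Prod>\<psi>\<in>annihilator (unit_group q) H. L_P P q (real t * s) \<psi>))"

definition V_vec :: "real \<Rightarrow> nat \<Rightarrow> real \<Rightarrow> nat \<Rightarrow> int set \<Rightarrow> real" where
  "V_vec P q s t A = ln (zeta_P P q (real t * s) A)"

definition M1_inv :: "nat \<Rightarrow> int set \<Rightarrow> int set \<Rightarrow> real" where
  "M1_inv q A K =
     (let G = unit_group q; B = generate G A in
      if K \<subseteq> B
      then of_int (moebius_mu (quot_order G B K)) / real (quot_order G (carrier G) K)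
      else 0)"

definition N_mat :: "nat \<Rightarrow> nat \<Rightarrow> int set \<Rightarrow> int set \<Rightarrow> real" where
  "N_mat q d B0 B1 =
     (let G = unit_group q in
      \<Sum>K | subgroup K G \<and> K \<subseteq> B0 \<and> quot_order G (K <#>\<^bsub>G\<^esub> B1) K = d.
        of_int (moebius_mu (quot_order G B0 K)))"

definition mat_vec :: "'j set \<Rightarrow> ('i \<Rightarrow> 'j \<Rightarrow> real) \<Rightarrow> ('j \<Rightarrow> real) \<Rightarrow> 'i \<Rightarrow> real" where
  "mat_vec J M w i = (\<Sum>j\<in>J. M i j * w j)"

definition max_norm :: "'i set \<Rightarrow> ('i \<Rightarrow> real) \<Rightarrow> real" where
  "max_norm I w = Max ((\<lambda>i. \<bar>w i\<bar>) ` I)"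

text \<open>
  \<open>N_mat\<close> is indexed by cyclic subgroups; it acts here on vectors indexed by lattice-invariant
  classes through the bijection \<open>A \<mapsto> generate G A\<close>.
\<close>

definition N_class :: "nat \<Rightarrow> nat \<Rightarrow> int set \<Rightarrow> int set \<Rightarrow> real" where
  "N_class q d A B =
     N_mat q d (generate (unit_group q) A) (generate (unit_group q) B)"

text \<open>
  For \<open>ds = [d\<^sub>1, \<dots>, d\<^sub>v]\<close>, this is
  \<open>(N\<^bsub>d\<^sub>1\<^esub> / d\<^sub>1) \<cdots> (N\<^bsub>d\<^sub>v\<^esub> / d\<^sub>v) M\<^sub>1\<^sup>-\<^sup>1 \<Gamma>\<^sub>s(d\<^sub>1 \<cdots> d\<^sub>v)\<close>,
  the matrices being applied from right to left.
\<close>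

definition term_vec :: "real \<Rightarrow> nat \<Rightarrow> real \<Rightarrow> nat list \<Rightarrow> int set \<Rightarrow> real" where
  "term_vec P q s ds =
     foldr (\<lambda>d. mat_vec (lattice_classes (unit_group q)) (\<lambda>A B. N_class q d A B / real d)) ds
       (mat_vec (cyclic_subgroups (unit_group q)) (M1_inv q) (Gamma_vec P q s (prod_list ds)))"

definition divisor_tuples :: "nat \<Rightarrow> nat \<Rightarrow> nat \<Rightarrow> nat list set" where
  "divisor_tuples q v b =
     {ds. length ds = v \<and> (\<forall>d\<in>set ds. d dvd group_exp (unit_group q) \<and> d \<noteq> 1) \<and>
          prod_list ds \<le> b}"

end

theory Submission
  imports Defs
begin

text \<open>
  For a prime \<open>p\<close> in the class \<open>g\<close>, the product of \<open>1 - \<psi>(p) p\<^sup>-\<^sup>f\<close> over the characters \<open>\<psi>\<close>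
  trivial on \<open>K\<close> equals \<open>(1 - p\<^sup>-\<^sup>m\<^sup>f)\<close> to the power \<open>|G/K| / m\<close>, where \<open>m\<close> is the order of \<open>g\<close>
  modulo \<open>K\<close>. Hence \<open>\<Gamma>\<close> is a combination of the values of \<open>V\<close> at multiples of the argument, and
  Moebius inversion over the subgroups of a cyclic group turns this into
  \<open>V(t) = M\<^sub>1\<^sup>-\<^sup>1 \<Gamma>(t) - (\<Sum>d>1. N\<^sub>d / d V(d t))\<close>, because \<open>N\<^sub>1\<close> is the identity.

  This is iterated along the tuples whose product stays below \<open>2\<^sup>r\<close>. In every remaining term
  \<open>V\<close> is evaluated at \<open>2\<^sup>r\<close> or beyond. The entries of \<open>N\<^sub>d\<close> are at most 1 in absolute value, and the
  entries of \<open>V\<close> are nonnegative with a sum bounded by the tail of a zeta function, so that the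
  innermost matrix of a product costs no factor \<open>|G\<^sup>\<sharp>|\<close>. For tuples of length \<open>r\<close> the decay of
  this tail in the argument replaces the number of tuples by \<open>(4/3)\<^sup>r\<close>.
\<close>

section \<open>Orders modulo a subgroup\<close>

text \<open>The target bound dictates the estimates. Each matrix \<open>N_d / d\<close> brings a
  factor 1/d, and every tuple left over has product at least 2^r; this accounts for the r factors
  1/2. A tuple that passes 2^r at a length v < r costs at most the power v - 1 of the number of
  classes, and counting such tuples is enough; the r - 1 lengths together give the summand with
  numerator r - 1. At length r counting fails: there may be up to (d(exp G) - 1)^r tuples, in
  general more than the d(exp G)^(r-1) that the bound allows. But the divisors are distinct
  integers, so most of these tuples have products far above 2^r, where the tail is exponentially
  smaller.

  The other obstacle is the bound 1 for the entries of \<open>N_d\<close>, which are sums over many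
  subgroups. For generators a and b of two cyclic groups, the condition that K and b generate a
  group of index d over K, with K generated by a^e, depends on e only through the lcm of e and a
  fixed f. If f \<noteq> 1, a sign-reversing pairing cancels everything; if f = 1, at most one e
  qualifies.\<close>

definition relative_order :: "('a, 'b) monoid_scheme \<Rightarrow> 'a set \<Rightarrow> 'a \<Rightarrow> nat" where
  "relative_order G K g = group.ord (G Mod K) (K #>\<^bsub>G\<^esub> g)"

locale finite_comm_group = comm_group G for G :: "'a monoid" (structure) +
  assumes finite_carrier: "finite (carrier G)"
begin

lemma finite_subgroup: "subgroup K G \<Longrightarrow> finite K"
  using finite_carrier finite_subset subgroup.subset by blast

lemma card_subgroup_pos: "subgroup K G \<Longrightarrow> card K > 0"
  using finite_subgroup subgroup.one_closed by (fastforce simp: card_gt_0_iff)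

lemma pow_mem_iff_relative_order_dvd:
  assumes "subgroup K G" "g \<in> carrier G"
  shows "g [^] (n::nat) \<in> K \<longleftrightarrow> relative_order G K g dvd n"
proof -
  interpret K: normal K G using assms(1) by (rule subgroup_imp_normal)
  interpret Q: group "G Mod K" by (rule K.factorgroup_is_group)
  have mem: "K #> g \<in> carrier (G Mod K)"
    using assms(2) by (simp add: carrier_FactGroup)
  have "g [^] n \<in> K \<longleftrightarrow> K #> (g [^] n) = K"
    using assms coset_join1[of K "g [^] n"] coset_join2[of "g [^] n" K] by auto
  also have "K #> (g [^] n) = (K #> g) [^]\<^bsub>G Mod K\<^esub> n"
    using assms(2) by (simp add: K.FactGroup_pow)
  also have "\<dots> = K \<longleftrightarrow> relative_order G K g dvd n"
    using Q.pow_eq_id[OF mem] by (simp add: relative_order_def)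
  finally show ?thesis .
qed

lemma ord_pos: "g \<in> carrier G \<Longrightarrow> group.ord G g > 0"
  using ord_ge_1[OF finite_carrier] by fastforce

lemma relative_order_dvd_ord:
  "subgroup K G \<Longrightarrow> g \<in> carrier G \<Longrightarrow> relative_order G K g dvd group.ord G g"
  using pow_mem_iff_relative_order_dvd[of K g "group.ord G g"] by (simp add: subgroup.one_closed)

lemma relative_order_pos:
  "subgroup K G \<Longrightarrow> g \<in> carrier G \<Longrightarrow> relative_order G K g > 0"
  using relative_order_dvd_ord ord_pos by (metis dvd_pos_nat)

lemma quot_order_mult_card:
  assumes "subgroup B G" "subgroup K G" "K \<subseteq> B"
  shows "quot_order G B K * card K = card B"
proof -
  interpret B: group "G\<lparr>carrier := B\<rparr>"
    using assms(1) subgroup.subgroup_is_group is_group by blast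
  have "subgroup K (G\<lparr>carrier := B\<rparr>)"
    using assms by (simp add: subgroup_incl)
  from B.lagrange[OF this] show ?thesis
    by (simp add: quot_order_def order_def FactGroup_def)
qed

lemma quot_order_pos:
  assumes "subgroup B G" "subgroup K G" "K \<subseteq> B"
  shows "quot_order G B K > 0"
  using quot_order_mult_card[OF assms] card_subgroup_pos[OF assms(1)] by (metis mult_is_0 neq0_conv)

lemma generate_singleton_eq_range:
  "g \<in> carrier G \<Longrightarrow> generate G {g} = range (\<lambda>n::nat. g [^] n)"
  using generate_pow_on_finite_carrier[OF finite_carrier] by auto

lemma subgroup_generate_singleton: "g \<in> carrier G \<Longrightarrow> subgroup (generate G {g}) G"
  by (simp add: generate_is_subgroup)

lemma subgroup_set_mult: "subgroup K G \<Longrightarrow> subgroup B G \<Longrightarrow> subgroup (K <#> B) G"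
  using mult_subgroups by blast

lemma subset_set_mult:
  assumes "subgroup K G" "subgroup B G"
  shows "K \<subseteq> K <#> B" "B \<subseteq> K <#> B"
proof -
  have "k \<otimes> \<one> \<in> K <#> B" if "k \<in> K" for k
    using that subgroup.one_closed[OF assms(2)] unfolding set_mult_def by blast
  then show "K \<subseteq> K <#> B"
    using subgroup.mem_carrier[OF assms(1)] by auto
  have "\<one> \<otimes> b \<in> K <#> B" if "b \<in> B" for b
    using that subgroup.one_closed[OF assms(1)] unfolding set_mult_def by blast
  then show "B \<subseteq> K <#> B"
    using subgroup.mem_carrier[OF assms(2)] by auto
qed

text \<open>Multiplying by an element of \<open>K\<close> on the left does not change a coset of
  \<open>K\<close>, so the cosets inside \<open>K <#> generate G {g}\<close> are exactly the powers
  of the coset of \<open>g\<close>. Indices of this kind thereby become orders, which are handled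
  through divisibility of exponents.\<close>

lemma quot_order_set_mult_generate:
  assumes "subgroup K G" "g \<in> carrier G"
  shows "quot_order G (K <#> generate G {g}) K = relative_order G K g"
proof -
  let ?B = "generate G {g}"
  interpret K: normal K G using assms(1) by (rule subgroup_imp_normal)
  interpret Q: group "G Mod K" by (rule K.factorgroup_is_group)
  have mem: "K #> g \<in> carrier (G Mod K)"
    using assms(2) by (simp add: carrier_FactGroup)
  have finQ: "finite (carrier (G Mod K))"
    using finite_carrier by (simp add: carrier_FactGroup)
  have coset: "K #> (k \<otimes> b) = K #> b" if "k \<in> K" "b \<in> carrier G" for k b
    using that coset_mult_assoc[OF K.subset, of k b] K.rcos_const[of k] by simp
  have sub: "?B \<subseteq> carrier G"
    using assms(2) by (simp add: generate_in_carrier generate_incl)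
  have "rcosets\<^bsub>G\<lparr>carrier := K <#> ?B\<rparr>\<^esub> K = (\<lambda>x. K #> x) ` (K <#> ?B)"
    by (auto simp: RCOSETS_def r_coset_def)
  also have "\<dots> = (\<lambda>x. K #> x) ` ?B"
  proof
    show "(\<lambda>x. K #> x) ` (K <#> ?B) \<subseteq> (\<lambda>x. K #> x) ` ?B"
    proof (rule image_subsetI)
      fix x assume "x \<in> K <#> ?B"
      then obtain k b where kb: "k \<in> K" "b \<in> ?B" "x = k \<otimes> b"
        unfolding set_mult_def by blast
      then have "K #> x = K #> b" using coset sub by blast
      then show "K #> x \<in> (\<lambda>x. K #> x) ` ?B" using kb(2) by blast
    qed
    show "(\<lambda>x. K #> x) ` ?B \<subseteq> (\<lambda>x. K #> x) ` (K <#> ?B)"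
      using subset_set_mult(2)[OF assms(1) subgroup_generate_singleton[OF assms(2)]] by blast
  qed
  also have "\<dots> = generate (G Mod K) {K #> g}"
    using Q.generate_pow_on_finite_carrier[OF finQ mem] assms(2)
    by (auto simp: generate_singleton_eq_range K.FactGroup_pow)
  finally show ?thesis
    using Q.generate_pow_card[OF mem]
    by (simp add: quot_order_def relative_order_def order_def FactGroup_def)
qed

lemma card_set_mult_generate:
  assumes "subgroup K G" "g \<in> carrier G"
  shows "card (K <#> generate G {g}) = relative_order G K g * card K"
proof -
  note B = subgroup_generate_singleton[OF assms(2)]
  show ?thesis
    using quot_order_mult_card[OF subgroup_set_mult[OF assms(1) B] assms(1)]
      subset_set_mult(1)[OF assms(1) B] quot_order_set_mult_generate[OF assms] by simp
qed

section \<open>Element orders and the exponent\<close>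

lemma ord_mult_coprime:
  assumes "a \<in> carrier G" "b \<in> carrier G" "coprime (group.ord G a) (group.ord G b)"
  shows "group.ord G (a \<otimes> b) = group.ord G a * group.ord G b"
proof (rule dvd_antisym)
  show "group.ord G (a \<otimes> b) dvd group.ord G a * group.ord G b"
    using assms(1,2) by (rule abelian_ord_mul_divides)
  let ?n = "group.ord G (a \<otimes> b)"
  have aux: "group.ord G x dvd group.ord G (x \<otimes> y)"
    if "x \<in> carrier G" "y \<in> carrier G" "coprime (group.ord G x) (group.ord G y)" for x y
  proof -
    let ?n = "group.ord G (x \<otimes> y)"
    \<comment> \<open>The extra factor kills \<open>y\<close>, so the vanishing of this power of the
      product passes to \<open>x\<close>; coprimality then removes the factor again.\<close>
    let ?k = "?n * group.ord G y"
    have "x [^] ?k \<otimes> y [^] ?k = (x \<otimes> y) [^] ?k"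
      using that by (simp add: pow_mult_distrib m_comm)
    also have "\<dots> = \<one>"
      using that pow_eq_id[of "x \<otimes> y" ?k] by simp
    finally have "x [^] ?k \<otimes> y [^] ?k = \<one>" .
    moreover have "y [^] ?k = \<one>"
      using that by (simp add: pow_eq_id)
    ultimately have "x [^] ?k = \<one>"
      using that by simp
    then have "group.ord G x dvd ?n * group.ord G y"
      using that by (simp add: pow_eq_id)
    then show ?thesis
      using that(3) by (simp add: coprime_dvd_mult_left_iff)
  qed
  have "group.ord G a dvd ?n" using aux assms by blast
  moreover have "group.ord G b dvd ?n"
    using aux[of b a] assms by (simp add: m_comm coprime_commute)
  ultimately show "group.ord G a * group.ord G b dvd ?n"
    using assms(3) by (simp add: divides_mult)
qed

text \<open>The exponent is given as a maximum, not as a common multiple. If some prime p occurred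
  to a higher power in the order of \<open>g\<close> than in the maximal order, attained at
  \<open>a\<close>, then the prime-to-p part of \<open>a\<close> times the p-part of
  \<open>g\<close> would have an even larger order.\<close>

lemma ord_dvd_group_exp:
  assumes g: "g \<in> carrier G"
  shows "group.ord G g dvd group_exp G"
proof (rule ccontr)
  assume not_dvd: "\<not> group.ord G g dvd group_exp G"
  have "group_exp G \<in> group.ord G ` carrier G"
    unfolding group_exp_def using finite_carrier g by (intro Max_in) auto
  then obtain a where a: "a \<in> carrier G" and ea: "group.ord G a = group_exp G" by auto
  have ub: "group.ord G x \<le> group.ord G a" if "x \<in> carrier G" for x
    unfolding ea group_exp_def using finite_carrier that by (intro Max_ge) auto
  let ?m = "group.ord G g" and ?n = "group.ord G a"
  have pos: "?m > 0" "?n > 0" using g a ord_pos by auto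
  obtain p where p: "prime p" and less: "multiplicity p ?n < multiplicity p ?m"
    using not_dvd[folded ea] pos(1) multiplicity_le_imp_dvd[of ?m ?n] not_le by blast
  define v w where "v = multiplicity p ?n" and "w = multiplicity p ?m"
  obtain n' where n': "?n = p ^ v * n'" "\<not> p dvd n'"
    using multiplicity_decompose'[of ?n p] pos not_prime_unit p unfolding v_def by blast
  obtain m' where m': "?m = p ^ w * m'" "\<not> p dvd m'"
    using multiplicity_decompose'[of ?m p] pos not_prime_unit p unfolding w_def by blast
  have p0: "p > 0" using p prime_gt_0_nat by blast
  have oa: "group.ord G (a [^] (p ^ v)) = n'"
    using ord_pow[OF a, of "p ^ v"] n'(1) p0 by simp
  have og: "group.ord G (g [^] m') = p ^ w"
    using ord_pow[OF g, of m'] m'(1) pos by simp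
  have "coprime n' (p ^ w)"
    using n'(2) p by (metis coprime_commute coprime_power_left_iff prime_imp_coprime)
  then have "group.ord G (a [^] (p ^ v) \<otimes> g [^] m') = n' * p ^ w"
    using ord_mult_coprime[of "a [^] (p ^ v)" "g [^] m'"] a g oa og by simp
  then have "n' * p ^ w \<le> p ^ v * n'"
    using ub[of "a [^] (p ^ v) \<otimes> g [^] m'"] a g n'(1) by simp
  then have "p ^ w \<le> p ^ v"
    using pos n'(1) by simp
  moreover have "p ^ v < p ^ w"
    using less v_def w_def p prime_gt_1_nat power_strict_increasing by blast
  ultimately show False by simp
qed

lemma group_exp_pos: "group_exp G > 0"
proof -
  have "group_exp G \<in> group.ord G ` carrier G"
    unfolding group_exp_def using finite_carrier by (intro Max_in) auto
  then show ?thesis using ord_pos by auto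
qed

lemma relative_order_dvd_group_exp:
  "subgroup K G \<Longrightarrow> g \<in> carrier G \<Longrightarrow> relative_order G K g dvd group_exp G"
  using relative_order_dvd_ord ord_dvd_group_exp dvd_trans by blast

end

section \<open>Characters trivial on a subgroup\<close>

text \<open>Both sides are polynomials in \<open>z\<close> of degree at most \<open>m\<close>. They
  agree at 0 and at the \<open>m\<close> roots of unity themselves, whose inverses are again roots
  of unity, hence at m + 1 points.\<close>

lemma prod_roots_unity:
  fixes z :: complex
  assumes "m > 0"
  shows "(\<Prod>w | w ^ m = 1. 1 - w * z) = 1 - z ^ m"
proof -
  let ?R = "{w::complex. w ^ m = 1}"
  have fin: "finite ?R" and card: "card ?R = m"
    using assms finite_roots_unity[of m] card_roots_unity_eq by simp_all
  define p where "p = (\<Prod>w\<in>?R. [:1, - w:])"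
  define q :: "complex poly" where "q = 1 - Polynomial.monom 1 m"
  have "degree p \<le> (\<Sum>w\<in>?R. degree [:1, - w:])"
    unfolding p_def by (rule degree_prod_sum_le[OF fin, unfolded o_def])
  also have "\<dots> \<le> (\<Sum>w\<in>?R. 1)" by (rule sum_mono) simp
  finally have degp: "degree p \<le> m" using card by simp
  have degq: "degree q \<le> m"
    unfolding q_def by (intro degree_diff_le) (simp_all add: degree_monom_le)
  have zero: "0 \<notin> ?R" using assms by (simp add: power_0_left)
  have "poly p x = poly q x" if x: "x \<in> insert 0 ?R" for x
  proof (cases "x = 0")
    case True
    then show ?thesis using assms by (simp add: p_def q_def poly_prod poly_monom power_0_left)
  next
    case False
    with x have "inverse x \<in> ?R" by (simp add: power_inverse)
    then have "poly p x = 0"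
      using fin False by (auto simp: p_def poly_prod intro!: bexI[of _ "inverse x"])
    then show ?thesis using x False by (simp add: q_def poly_monom)
  qed
  then have "p = q"
    by (rule poly_eqI_degree[of "insert 0 ?R"]) (use degp degq fin card zero in simp_all)
  then have "poly p z = poly q z" by simp
  then show ?thesis by (simp add: p_def q_def poly_prod poly_monom mult.commute)
qed

text \<open>The annihilator is the case of the constant function 1. General \<open>\<phi>\<close> is
  needed because extending the trivial character by one element already leads to nontrivial ones,
  and the count below is an induction over such extensions.\<close>

definition char_extensions :: "'a monoid \<Rightarrow> 'a set \<Rightarrow> ('a \<Rightarrow> complex) \<Rightarrow> ('a \<Rightarrow> complex) set" where
  "char_extensions G H \<phi> = {\<psi> \<in> characters G. \<forall>h\<in>H. \<psi> h = \<phi> h}"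

lemma hom_complex_units_iff:
  "\<phi> \<in> hom G complex_units \<longleftrightarrow>
     (\<forall>x\<in>carrier G. \<phi> x \<noteq> 0) \<and> (\<forall>x\<in>carrier G. \<forall>y\<in>carrier G. \<phi> (x \<otimes>\<^bsub>G\<^esub> y) = \<phi> x * \<phi> y)"
  by (auto simp: hom_def complex_units_def Pi_iff)

context finite_comm_group
begin

lemma complex_hom_one:
  assumes "subgroup H G" "\<phi> \<in> hom (G\<lparr>carrier := H\<rparr>) complex_units"
  shows "\<phi> \<one> = 1"
proof -
  have "\<forall>x\<in>H. \<phi> x \<noteq> 0" "\<forall>x\<in>H. \<forall>y\<in>H. \<phi> (x \<otimes> y) = \<phi> x * \<phi> y"
    using assms(2) by (simp_all add: hom_complex_units_iff)
  then have "\<phi> \<one> \<noteq> 0" "\<phi> (\<one> \<otimes> \<one>) = \<phi> \<one> * \<phi> \<one>"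
    using subgroup.one_closed[OF assms(1)] by blast+
  then show ?thesis by simp
qed

lemma complex_hom_pow:
  assumes H: "subgroup H G" and \<phi>: "\<phi> \<in> hom (G\<lparr>carrier := H\<rparr>) complex_units" and x: "x \<in> H"
  shows "\<phi> (x [^] (n::nat)) = \<phi> x ^ n"
proof (induction n)
  case 0
  then show ?case using complex_hom_one[OF H \<phi>] by simp
next
  case (Suc n)
  have "x [^] n \<in> H"
    using subgroup_int_pow_closed[OF H x, of "int n"] by (simp add: int_pow_int)
  then show ?case using Suc \<phi> x by (simp add: hom_complex_units_iff)
qed

lemma character_pow:
  assumes "\<psi> \<in> hom G complex_units" "g \<in> carrier G"
  shows "\<psi> (g [^] (n::nat)) = \<psi> g ^ n"
  using complex_hom_pow[OF subgroup_self] assms by simp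

lemma mem_set_mult_generate_iff:
  assumes "g \<in> carrier G"
  shows "x \<in> H <#> generate G {g} \<longleftrightarrow> (\<exists>h\<in>H. \<exists>n::nat. x = h \<otimes> g [^] n)"
  using generate_singleton_eq_range[OF assms] by (auto simp: set_mult_def)

text \<open>With m the relative order of \<open>g\<close>, every relation between powers of
  \<open>g\<close> and elements of \<open>H\<close> is a consequence of the one that expresses g^m
  in \<open>H\<close>. The equation for \<open>w\<close> is therefore the only obstruction to
  sending h g^n to \<open>\<phi> h * w ^ n\<close>.\<close>

lemma extend_complex_hom:
  assumes H: "subgroup H G" and g: "g \<in> carrier G"
    and \<phi>: "\<phi> \<in> hom (G\<lparr>carrier := H\<rparr>) complex_units"
    and w: "w ^ relative_order G H g = \<phi> (g [^] relative_order G H g)"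
  shows "\<exists>\<phi>'\<in>hom (G\<lparr>carrier := H <#> generate G {g}\<rparr>) complex_units.
    (\<forall>h\<in>H. \<phi>' h = \<phi> h) \<and> \<phi>' g = w"
proof -
  define m where "m = relative_order G H g"
  let ?H' = "H <#> generate G {g}"
  have m0: "m > 0" using relative_order_pos[OF H g] by (simp add: m_def)
  have gm: "g [^] m \<in> H" using pow_mem_iff_relative_order_dvd[OF H g] by (simp add: m_def)
  have HG: "h \<in> carrier G" if "h \<in> H" for h using that subgroup.mem_carrier[OF H] by blast
  have mult: "\<phi> (x \<otimes> y) = \<phi> x * \<phi> y" and nz: "\<phi> x \<noteq> 0" if "x \<in> H" "y \<in> H" for x y
    using \<phi> that by (auto simp: hom_complex_units_iff)
  have w0: "w \<noteq> 0"
    using w nz[OF gm gm] m0 unfolding m_def[symmetric] by (auto simp: power_0_left)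
  \<comment> \<open>Two representations of one element differ by a power of \<open>g\<close> lying
    in \<open>H\<close>, whose exponent is a multiple of \<open>m\<close>. Ordering the exponents
    keeps the natural-number difference meaningful.\<close>
  have le: "\<phi> h * w ^ n = \<phi> h' * w ^ n'"
    if h: "h \<in> H" "h' \<in> H" and eq: "h \<otimes> g [^] n = h' \<otimes> g [^] n'" and n: "n \<le> n'"
    for h h' and n n' :: nat
  proof -
    have "h \<otimes> g [^] n = (h' \<otimes> g [^] (n' - n)) \<otimes> g [^] n"
      using eq n g HG h by (simp add: m_assoc nat_pow_mult)
    then have h_eq: "h = h' \<otimes> g [^] (n' - n)"
      using g HG h by simp
    then have "g [^] (n' - n) = inv h' \<otimes> h"
      using g HG h by (simp add: inv_solve_left)
    then have "g [^] (n' - n) \<in> H"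
      using h H by (simp add: subgroup.m_closed subgroup.m_inv_closed)
    then obtain k where k: "n' - n = m * k"
      using pow_mem_iff_relative_order_dvd[OF H g] by (auto simp: m_def)
    have "g [^] (n' - n) = (g [^] m) [^] k" using g k by (simp add: nat_pow_pow)
    then have "\<phi> (g [^] (n' - n)) = w ^ (n' - n)"
      using complex_hom_pow[OF H \<phi> gm] w k by (simp add: m_def power_mult)
    then have "\<phi> h = \<phi> h' * w ^ (n' - n)"
      using h_eq mult h(2) \<open>g [^] (n' - n) \<in> H\<close> by simp
    then show ?thesis using n by (simp flip: power_add)
  qed
  have wd: "\<phi> h * w ^ n = \<phi> h' * w ^ n'"
    if "h \<in> H" "h' \<in> H" "h \<otimes> g [^] n = h' \<otimes> g [^] n'" for h h' and n n' :: nat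
    using le[of h h' n n'] le[of h' h n' n] that by (cases "n \<le> n'") simp_all
  define \<phi>' where "\<phi>' x = (THE c. \<exists>h\<in>H. \<exists>n::nat. x = h \<otimes> g [^] n \<and> c = \<phi> h * w ^ n)" for x
  have val: "\<phi>' (h \<otimes> g [^] n) = \<phi> h * w ^ n" if "h \<in> H" for h and n :: nat
    unfolding \<phi>'_def by (rule the_equality) (use that wd in \<open>fast, metis\<close>)
  have "\<phi>' \<in> hom (G\<lparr>carrier := ?H'\<rparr>) complex_units"
    unfolding hom_complex_units_iff
  proof (intro conjI ballI)
    fix x assume "x \<in> carrier (G\<lparr>carrier := ?H'\<rparr>)"
    then obtain h and n :: nat where x: "h \<in> H" "x = h \<otimes> g [^] n"
      using mem_set_mult_generate_iff[OF g] by auto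
    show "\<phi>' x \<noteq> 0" using x val nz w0 by simp
    fix y assume "y \<in> carrier (G\<lparr>carrier := ?H'\<rparr>)"
    then obtain h' and n' :: nat where y: "h' \<in> H" "y = h' \<otimes> g [^] n'"
      using mem_set_mult_generate_iff[OF g] by auto
    have "h \<in> carrier G" "h' \<in> carrier G" "g [^] n \<in> carrier G" "g [^] n' \<in> carrier G"
      using HG x(1) y(1) g by auto
    then have "x \<otimes> y = (h \<otimes> h') \<otimes> (g [^] n \<otimes> g [^] n')"
      unfolding x(2) y(2) by (simp add: m_ac)
    then have "x \<otimes> y = (h \<otimes> h') \<otimes> g [^] (n + n')"
      using g by (simp add: nat_pow_mult)
    moreover have "h \<otimes> h' \<in> H" using subgroup.m_closed[OF H x(1) y(1)] .
    ultimately have "\<phi>' (x \<otimes> y) = \<phi>' x * \<phi>' y"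
      using x y val mult by (simp add: power_add)
    then show "\<phi>' (x \<otimes>\<^bsub>G\<lparr>carrier := ?H'\<rparr>\<^esub> y) = \<phi>' x * \<phi>' y" by simp
  qed
  moreover have "\<phi>' h = \<phi> h" if "h \<in> H" for h
    using val[OF that, of 0] that HG by simp
  moreover have "\<phi>' g = w"
    using val[of \<one> 1] subgroup.one_closed[OF H] complex_hom_one[OF H \<phi>] g by simp
  ultimately show ?thesis by blast
qed

text \<open>Values on \<open>H\<close> and at \<open>g\<close> determine a character on everything
  that \<open>H\<close> and \<open>g\<close> generate. Fixing the value at \<open>g\<close> is thus
  the same as enlarging the subgroup, which drives the induction that follows.\<close>

lemma char_extensions_fiber:
  assumes H: "subgroup H G" and g: "g \<in> carrier G"
    and \<phi>': "\<phi>' \<in> hom (G\<lparr>carrier := H <#> generate G {g}\<rparr>) complex_units"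
    and eq: "\<And>h. h \<in> H \<Longrightarrow> \<phi>' h = \<phi> h"
  shows "{\<psi> \<in> char_extensions G H \<phi>. \<psi> g = \<phi>' g} = char_extensions G (H <#> generate G {g}) \<phi>'"
proof -
  let ?B = "generate G {g}" and ?H' = "H <#> generate G {g}"
  note B = subgroup_generate_singleton[OF g]
  have sub: "H \<subseteq> ?H'" "?B \<subseteq> ?H'" "subgroup ?H' G"
    using subset_set_mult[OF H B] subgroup_set_mult[OF H B] by auto
  have gB: "g \<in> ?H'" using sub(2) generate.incl[of g "{g}" G] by auto
  have "\<psi> x = \<phi>' x" if \<psi>: "\<psi> \<in> char_extensions G H \<phi>" "\<psi> g = \<phi>' g" and x: "x \<in> ?H'" for \<psi> x
  proof -
    obtain h and n :: nat where hn: "h \<in> H" "x = h \<otimes> g [^] n"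
      using x mem_set_mult_generate_iff[OF g] by auto
    have hc: "h \<in> carrier G" using subgroup.mem_carrier[OF H hn(1)] .
    have gn: "g [^] n \<in> ?H'"
      using sub(2) unfolding generate_singleton_eq_range[OF g] by blast
    have \<psi>hom: "\<psi> \<in> hom G complex_units"
      using \<psi> by (simp add: char_extensions_def characters_def)
    have "\<psi> x = \<psi> h * \<psi> g ^ n"
      using \<psi>hom hn hc g character_pow[OF \<psi>hom g] by (simp add: hom_complex_units_iff)
    also have "\<dots> = \<phi>' h * \<phi>' g ^ n"
      using \<psi> hn eq by (simp add: char_extensions_def)
    also have "\<dots> = \<phi>' x"
      using \<phi>' hn gn subsetD[OF sub(1) hn(1)] complex_hom_pow[OF sub(3) \<phi>' gB]
      by (simp add: hom_complex_units_iff)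
    finally show ?thesis .
  qed
  then show ?thesis
    using sub gB eq by (auto simp: char_extensions_def subset_iff)
qed

text \<open>Induction on the size of the complement of \<open>H\<close>. For \<open>g\<close>
  outside \<open>H\<close> of relative order m, the possible values at \<open>g\<close> are the m
  roots of \<open>w ^ m = \<phi> (g [^] m)\<close>; each fibre is counted by the induction
  hypothesis for a subgroup m times as large.\<close>

lemma card_char_extensions:
  assumes "subgroup H G" "\<phi> \<in> hom (G\<lparr>carrier := H\<rparr>) complex_units"
  shows "card (char_extensions G H \<phi>) * card H = card (carrier G)"
  using assms
proof (induction "card (carrier G) - card H" arbitrary: H \<phi> rule: less_induct)
  case (less H \<phi>)
  note H = less.prems(1) and \<phi> = less.prems(2)
  have HG: "H \<subseteq> carrier G" using H subgroup.subset by blast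
  show ?case
  proof (cases "H = carrier G")
    case True
    have "char_extensions G H \<phi> = {restrict \<phi> (carrier G)}"
    proof (intro equalityI subsetI)
      fix \<psi> assume "\<psi> \<in> char_extensions G H \<phi>"
      then have "\<psi> = restrict \<phi> (carrier G)"
        by (intro extensionalityI[of _ "carrier G"])
          (auto simp: char_extensions_def characters_def True)
      then show "\<psi> \<in> {restrict \<phi> (carrier G)}" by simp
    next
      fix \<psi> assume "\<psi> \<in> {restrict \<phi> (carrier G)}"
      then show "\<psi> \<in> char_extensions G H \<phi>"
        using \<phi> by (simp add: char_extensions_def characters_def True hom_complex_units_iff)
    qed
    then show ?thesis by (simp add: True)
  next
    case False
    then obtain g where g: "g \<in> carrier G" "g \<notin> H" using HG by blast
    define m where "m = relative_order G H g"
    let ?H' = "H <#> generate G {g}"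
    let ?R = "{w. w ^ m = \<phi> (g [^] m)}"
    note B = subgroup_generate_singleton[OF g(1)]
    have m0: "m > 0" using relative_order_pos[OF H g(1)] by (simp add: m_def)
    have m1: "m \<noteq> 1"
      using pow_mem_iff_relative_order_dvd[OF H g(1), of 1] g by (auto simp: m_def)
    have gm: "g [^] m \<in> H" using pow_mem_iff_relative_order_dvd[OF H g(1)] by (simp add: m_def)
    have H': "subgroup ?H' G" using subgroup_set_mult[OF H B] .
    have cardH': "card ?H' = m * card H"
      using card_set_mult_generate[OF H g(1)] by (simp add: m_def)
    have cH: "card H > 0" using card_subgroup_pos[OF H] .
    have lt: "card H < card ?H'"
      using cardH' cH m0 m1 by simp
    have "card ?H' \<le> card (carrier G)"
      using H' finite_carrier card_mono subgroup.subset by blast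
    with lt have dec: "card (carrier G) - card ?H' < card (carrier G) - card H" by linarith
    have nz: "\<phi> (g [^] m) \<noteq> 0" using \<phi> gm by (simp add: hom_complex_units_iff)
    have finR: "finite ?R" using m0 by (rule finite_nth_roots)
    have cardR: "card ?R = m" using card_nth_roots[OF nz m0] .
    let ?F = "\<lambda>w. {\<psi> \<in> char_extensions G H \<phi>. \<psi> g = w}"
    have fiber: "card (?F w) * card ?H' = card (carrier G)" if "w \<in> ?R" for w
    proof -
      have "w ^ relative_order G H g = \<phi> (g [^] relative_order G H g)"
        using that by (simp add: m_def)
      from extend_complex_hom[OF H g(1) \<phi> this]
      obtain \<phi>' where \<phi>': "\<phi>' \<in> hom (G\<lparr>carrier := ?H'\<rparr>) complex_units"
        "\<And>h. h \<in> H \<Longrightarrow> \<phi>' h = \<phi> h" "\<phi>' g = w"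
        by blast
      show ?thesis
        using less.hyps[OF dec H' \<phi>'(1)] char_extensions_fiber[OF H g(1) \<phi>'(1,2)] \<phi>'(3) by simp
    qed
    have cG: "card (carrier G) > 0" using card_subgroup_pos[OF subgroup_self] .
    \<comment> \<open>An infinite set has \<open>card\<close> 0, which the fibre count excludes
      since the group is nonempty.\<close>
    have finF: "finite (?F w)" if "w \<in> ?R" for w
    proof (rule ccontr)
      assume inf: "infinite (?F w)"
      show False using fiber[OF that] cG unfolding card.infinite[OF inf] by simp
    qed
    have UN: "char_extensions G H \<phi> = (\<Union>w\<in>?R. ?F w)"
    proof (intro equalityI subsetI)
      fix \<psi> assume \<psi>: "\<psi> \<in> char_extensions G H \<phi>"
      then have "\<psi> g ^ m = \<phi> (g [^] m)"
        using character_pow[of \<psi> g m] g gm by (auto simp: char_extensions_def characters_def)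
      then show "\<psi> \<in> (\<Union>w\<in>?R. ?F w)" using \<psi> by blast
    qed blast
    have "card (char_extensions G H \<phi>) = card (\<Union>w\<in>?R. ?F w)"
      using UN by (rule arg_cong)
    also have "\<dots> = (\<Sum>w\<in>?R. card (?F w))"
      by (rule card_UN_disjoint) (use finR finF in auto)
    finally have "card (char_extensions G H \<phi>) = (\<Sum>w\<in>?R. card (?F w))" .
    then have "card (char_extensions G H \<phi>) * card ?H' = m * card (carrier G)"
      using fiber cardR by (simp add: sum_distrib_right)
    then show ?thesis using cardH' m0 by (simp add: mult_ac)
  qed
qed

lemma one_complex_hom: "(\<lambda>_. 1) \<in> hom (G\<lparr>carrier := H\<rparr>) complex_units"
  by (simp add: hom_complex_units_iff)

lemma annihilator_eq_char_extensions: "annihilator G H = char_extensions G H (\<lambda>_. 1)"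
  by (simp add: annihilator_def char_extensions_def)

lemma finite_annihilator:
  assumes "subgroup H G"
  shows "finite (annihilator G H)"
proof (rule ccontr)
  assume inf: "infinite (annihilator G H)"
  show False
    using card_char_extensions[OF assms one_complex_hom] card_subgroup_pos[OF subgroup_self] inf
    by (simp add: annihilator_eq_char_extensions)
qed

text \<open>Evaluation at \<open>g\<close> maps the annihilator onto the \<open>m\<close>-th roots
  of unity with fibres of the common size \<open>N div m\<close>, so the product is a power of the
  one over roots of unity.\<close>

lemma prod_annihilator:
  assumes H: "subgroup H G" and g: "g \<in> carrier G"
  defines "m \<equiv> relative_order G H g" and "N \<equiv> quot_order G (carrier G) H"
  shows "m dvd N"
    and "(\<Prod>\<psi>\<in>annihilator G H. 1 - \<psi> g * z) = (1 - z ^ m) ^ (N div m)"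
proof -
  let ?H' = "H <#> generate G {g}"
  note B = subgroup_generate_singleton[OF g]
  have m0: "m > 0" using relative_order_pos[OF H g] by (simp add: m_def)
  have H': "subgroup ?H' G" using subgroup_set_mult[OF H B] .
  have N: "N * card H = card (carrier G)"
    unfolding N_def using quot_order_mult_card[OF subgroup_self H] subgroup.subset[OF H] by simp
  have cH: "card H > 0" using card_subgroup_pos[OF H] .
  have gm: "g [^] m \<in> H" using pow_mem_iff_relative_order_dvd[OF H g] by (simp add: m_def)
  let ?F = "\<lambda>w. {\<psi> \<in> annihilator G H. \<psi> g = w}"
  have fiber: "N = card (?F w) * m" if "w ^ m = 1" for w
  proof -
    have "w ^ relative_order G H g = 1" using that by (simp add: m_def)
    from extend_complex_hom[OF H g one_complex_hom this]
    obtain \<phi>' where \<phi>': "\<phi>' \<in> hom (G\<lparr>carrier := ?H'\<rparr>) complex_units"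
      "\<And>h. h \<in> H \<Longrightarrow> \<phi>' h = 1" "\<phi>' g = w"
      by blast
    have "card (?F w) * card ?H' = N * card H"
      using card_char_extensions[OF H' \<phi>'(1)] char_extensions_fiber[OF H g \<phi>'(1,2)] \<phi>'(3) N
      by (simp add: annihilator_eq_char_extensions)
    then show ?thesis
      using card_set_mult_generate[OF H g] cH by (simp add: m_def)
  qed
  show "m dvd N" using fiber[of 1] by simp
  have card_fiber: "card (?F w) = N div m" if "w ^ m = 1" for w
    using fiber[OF that] m0 by simp
  have "(\<lambda>\<psi>. \<psi> g) ` annihilator G H \<subseteq> {w. w ^ m = 1}"
  proof safe
    fix \<psi> assume "\<psi> \<in> annihilator G H"
    then show "\<psi> g ^ m = 1"
      using character_pow[of \<psi> g m] g gm by (auto simp: annihilator_def characters_def)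
  qed
  then have "(\<Prod>\<psi>\<in>annihilator G H. 1 - \<psi> g * z)
      = (\<Prod>w | w ^ m = 1. \<Prod>\<psi>\<in>?F w. 1 - \<psi> g * z)"
    by (intro prod.group[symmetric] finite_annihilator H finite_nth_roots m0)
  also have "\<dots> = (\<Prod>w | w ^ m = 1. (1 - w * z) ^ (N div m))"
    by (intro prod.cong refl) (simp add: card_fiber)
  also have "\<dots> = (1 - z ^ m) ^ (N div m)"
    by (simp add: prod_roots_unity[OF m0] flip: prod_power_distrib)
  finally show "(\<Prod>\<psi>\<in>annihilator G H. 1 - \<psi> g * z) = (1 - z ^ m) ^ (N div m)" .
qed

end

section \<open>Moebius sums over subgroups of a cyclic group\<close>

lemma abs_moebius_mu_le: "\<bar>moebius_mu n\<bar> \<le> 1"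
  by (simp add: moebius_mu_def power_abs)

lemma moebius_mu_1: "moebius_mu 1 = 1"
  by (simp add: moebius_mu_def)

lemma moebius_mu_mult_prime:
  assumes "prime p" "\<not> p dvd e" "squarefree e"
  shows "squarefree (e * p)" "moebius_mu (e * p) = - moebius_mu e"
proof -
  have e0: "e \<noteq> 0" using assms(3) by (metis not_squarefree_0)
  have p0: "p \<noteq> 0" using assms(1) by auto
  have cop: "coprime e p" using assms by (metis coprime_commute prime_imp_coprime)
  show sq: "squarefree (e * p)"
    using assms cop by (simp add: squarefree_mult_coprime squarefree_prime)
  have "prime_factors (e * p) = insert p (prime_factors e)"
    using assms(1) e0 p0 by (simp add: prime_factors_product prime_prime_factors)
  moreover have "p \<notin> prime_factors e" using assms(2) by auto
  ultimately show "moebius_mu (e * p) = - moebius_mu e"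
    using sq assms(3) by (simp add: moebius_mu_def)
qed

text \<open>
  For a prime \<open>p\<close> dividing \<open>f\<close>, multiplying or dividing \<open>e\<close> by \<open>p\<close> changes the sign of
  \<open>moebius_mu e\<close> but neither \<open>lcm e f\<close> nor the divisibility of \<open>n\<close>.
\<close>
lemma sum_moebius_mu_lcm_eq_0:
  fixes n f :: nat
  assumes n: "n > 0" and f: "f dvd n" "f \<noteq> 1"
  shows "(\<Sum>e | e dvd n \<and> Q (lcm e f). moebius_mu e) = 0"
proof -
  obtain p where p: "prime p" "p dvd f" using f(2) prime_factor_nat by blast
  define S where "S = {e. squarefree e \<and> e dvd n \<and> Q (lcm e f)}"
  define t where "t e = (if p dvd e then e div p else e * p)" for e
  have p0: "p > 0" using p(1) by (rule prime_gt_0_nat)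
  have finS: "finite S" unfolding S_def using n by (auto intro: finite_subset[of _ "{..n}"] dvd_imp_le)
  have up: "e * p \<in> S \<longleftrightarrow> e \<in> S" if sq: "squarefree e" and nd: "\<not> p dvd e" for e
  proof -
    have cop: "coprime e p" using p(1) nd by (metis coprime_commute prime_imp_coprime)
    have "e * p dvd n \<longleftrightarrow> e dvd n"
      using cop p(2) f(1) divides_mult[of e n p] dvd_trans by (blast dest: dvd_mult_left)
    moreover have "lcm (e * p) f = lcm e f"
    proof -
      have "e * p = lcm e p" using cop by (simp add: lcm_coprime)
      then show ?thesis using p(2) by (simp add: lcm.assoc lcm_proj2_if_dvd_nat)
    qed
    ultimately show ?thesis
      using sq moebius_mu_mult_prime(1)[OF p(1) nd sq] by (simp add: S_def)
  qed
  have tS: "t e \<in> S" "t (t e) = e" "moebius_mu (t e) = - moebius_mu e" if e: "e \<in> S" for e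
  proof -
    have sq: "squarefree e" using e by (simp add: S_def)
    show "t e \<in> S" "t (t e) = e" "moebius_mu (t e) = - moebius_mu e"
    proof (atomize (full), cases "p dvd e")
      case True
      then obtain e' where e': "e = e' * p" by (metis dvdE mult.commute)
      have nd: "\<not> p dvd e'"
      proof
        assume "p dvd e'"
        then have "p ^ 2 dvd e" using e' by (simp add: power2_eq_square mult_dvd_mono)
        then show False using sq p(1) squarefreeD not_prime_unit by blast
      qed
      have sq': "squarefree e'" using sq e' squarefree_multD(1) by blast
      have "t e = e'" using e' p0 by (simp add: t_def)
      then show "t e \<in> S \<and> t (t e) = e \<and> moebius_mu (t e) = - moebius_mu e"
        using e up[OF sq' nd] e' nd moebius_mu_mult_prime(2)[OF p(1) nd sq'] by (simp add: t_def)
    next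
      case False
      then have te: "t e = e * p" by (simp add: t_def)
      show "t e \<in> S \<and> t (t e) = e \<and> moebius_mu (t e) = - moebius_mu e"
        using e te p0 up[OF sq False] moebius_mu_mult_prime(2)[OF p(1) False sq] by (simp add: t_def)
    qed
  qed
  have bij: "bij_betw t S S"
    by (rule bij_betw_byWitness[where f' = t]) (use tS in auto)
  have "(\<Sum>e | e dvd n \<and> Q (lcm e f). moebius_mu e) = (\<Sum>e\<in>S. moebius_mu e)"
    by (rule sum.mono_neutral_right)
      (use n in \<open>auto simp: S_def moebius_mu_def intro: finite_subset[of _ "{..n}"] dvd_imp_le\<close>)
  moreover have "(\<Sum>e\<in>S. moebius_mu e) = (\<Sum>e\<in>S. moebius_mu (t e))"
    by (rule sum.reindex_bij_betw[OF bij, symmetric])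
  moreover have "\<dots> = - (\<Sum>e\<in>S. moebius_mu e)"
    unfolding sum_negf[symmetric] by (rule sum.cong[OF refl tS(3)])
  ultimately show ?thesis by linarith
qed

context finite_comm_group
begin

lemma relative_order_eqI:
  assumes "subgroup K G" "g \<in> carrier G" "\<And>n::nat. g [^] n \<in> K \<longleftrightarrow> d dvd n"
  shows "relative_order G K g = d"
  using assms(3) pow_mem_iff_relative_order_dvd[OF assms(1,2)] by (metis dvd_antisym dvd_refl)

lemma generate_pow_subset:
  "a \<in> carrier G \<Longrightarrow> generate G {a [^] (e::nat)} \<subseteq> generate G {a}"
  by (auto simp: generate_singleton_eq_range nat_pow_pow)

text \<open>A power of \<open>a\<close> lies in \<open>K\<close> exactly when its exponent is a
  multiple of the relative order. For \<open>K\<close> inside the cyclic group this shows that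
  \<open>K\<close> is itself cyclic, with an explicit generator.\<close>

lemma Int_generate_eq:
  assumes K: "subgroup K G" and a: "a \<in> carrier G"
  shows "K \<inter> generate G {a} = generate G {a [^] relative_order G K a}"
proof -
  let ?e = "relative_order G K a"
  have iff: "a [^] j \<in> K \<longleftrightarrow> a [^] j \<in> generate G {a [^] ?e}" for j :: nat
  proof
    assume "a [^] j \<in> K"
    then obtain i where "j = ?e * i"
      using pow_mem_iff_relative_order_dvd[OF K a] by blast
    then have "a [^] j = (a [^] ?e) [^] i" using a by (simp add: nat_pow_pow)
    then show "a [^] j \<in> generate G {a [^] ?e}"
      using a by (simp add: generate_singleton_eq_range)
  next
    have "generate G {a [^] ?e} \<subseteq> K"
      using pow_mem_iff_relative_order_dvd[OF K a, of ?e] K by (intro generate_subgroup_incl) auto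
    then show "a [^] j \<in> generate G {a [^] ?e} \<Longrightarrow> a [^] j \<in> K" by blast
  qed
  note sub = generate_pow_subset[OF a, of ?e]
  have pow: "\<exists>j::nat. x = a [^] j" if "x \<in> generate G {a}" for x
    using that unfolding generate_singleton_eq_range[OF a] by blast
  show ?thesis
  proof (intro equalityI subsetI)
    fix x assume x: "x \<in> K \<inter> generate G {a}"
    then obtain j :: nat where "x = a [^] j" using pow by blast
    then show "x \<in> generate G {a [^] ?e}" using x iff by simp
  next
    fix x assume x: "x \<in> generate G {a [^] ?e}"
    then have xa: "x \<in> generate G {a}" using sub by blast
    then obtain j :: nat where "x = a [^] j" using pow by blast
    then show "x \<in> K \<inter> generate G {a}" using x xa iff by simp
  qed
qed

lemma card_Int_generate:
  assumes K: "subgroup K G" and a: "a \<in> carrier G"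
  shows "card (K \<inter> generate G {a}) * relative_order G K a = group.ord G a"
proof -
  have "card (K \<inter> generate G {a}) = group.ord G (a [^] relative_order G K a)"
    using a Int_generate_eq[OF K a] by (simp add: generate_pow_card)
  also have "\<dots> = group.ord G a div relative_order G K a"
    using a relative_order_dvd_ord[OF K a] relative_order_pos[OF K a] by (intro ord_pow) auto
  finally show ?thesis using relative_order_dvd_ord[OF K a] by simp
qed

lemma quot_order_generate:
  assumes K: "subgroup K G" and a: "a \<in> carrier G" and sub: "K \<subseteq> generate G {a}"
  shows "quot_order G (generate G {a}) K = relative_order G K a"
proof -
  have "quot_order G (generate G {a}) K * card K = relative_order G K a * card K"
    using quot_order_mult_card[OF subgroup_generate_singleton[OF a] K sub] card_Int_generate[OF K a]
      sub a by (simp add: inf.absorb1 generate_pow_card mult.commute)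
  then show ?thesis using card_subgroup_pos[OF K] by simp
qed

text \<open>Raising to the cofactor of \<open>e\<close> in the order of \<open>a\<close> kills every
  power of \<open>a [^] e\<close>, which forces \<open>e\<close> to divide the exponent of any power
  of \<open>a\<close> among them.\<close>

lemma pow_mem_generate_pow_iff:
  assumes a: "a \<in> carrier G" and e: "e dvd group.ord G a"
  shows "a [^] (j::nat) \<in> generate G {a [^] e} \<longleftrightarrow> e dvd j"
proof
  assume "a [^] j \<in> generate G {a [^] e}"
  then obtain i :: nat where i: "a [^] j = (a [^] e) [^] i"
    using a by (auto simp: generate_singleton_eq_range)
  obtain k where k: "group.ord G a = e * k" using e by blast
  have kpos: "k > 0" using k ord_pos[OF a] by simp
  have "a [^] (j * k) = (a [^] j) [^] k" using a by (simp add: nat_pow_pow)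
  also have "\<dots> = a [^] (group.ord G a * i)"
    unfolding i using a k by (simp add: nat_pow_pow mult_ac)
  also have "\<dots> = \<one>" using a by (simp add: pow_eq_id)
  finally have "e * k dvd j * k" using a k by (simp add: pow_eq_id)
  then show "e dvd j" using kpos by simp
next
  assume "e dvd j"
  then obtain i where "j = e * i" by blast
  then have "a [^] j = (a [^] e) [^] i" using a by (simp add: nat_pow_pow)
  then show "a [^] j \<in> generate G {a [^] e}"
    using a by (simp add: generate_singleton_eq_range)
qed

lemma relative_order_generate_pow:
  assumes "a \<in> carrier G" "e dvd group.ord G a"
  shows "relative_order G (generate G {a [^] e}) a = e"
  using assms by (intro relative_order_eqI subgroup_generate_singleton pow_mem_generate_pow_iff) auto

text \<open>Subgroups are parametrised by their index \<open>e\<close> rather than by their order,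
  because the index is what the Moebius function is applied to.\<close>

lemma bij_betw_divisors_subgroups:
  assumes a: "a \<in> carrier G"
  shows "bij_betw (\<lambda>e. generate G {a [^] e}) {e. e dvd group.ord G a}
           {K. subgroup K G \<and> K \<subseteq> generate G {a}}"
proof (rule bij_betw_byWitness[where f' = "\<lambda>K. relative_order G K a"])
  show "\<forall>e\<in>{e. e dvd group.ord G a}. relative_order G (generate G {a [^] e}) a = e"
    using relative_order_generate_pow[OF a] by blast
  show "\<forall>K\<in>{K. subgroup K G \<and> K \<subseteq> generate G {a}}. generate G {a [^] relative_order G K a} = K"
    using Int_generate_eq[OF _ a] by (auto simp: inf.absorb1)
  show "(\<lambda>e. generate G {a [^] e}) ` {e. e dvd group.ord G a}
      \<subseteq> {K. subgroup K G \<and> K \<subseteq> generate G {a}}"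
    using subgroup_generate_singleton[of "a [^] (_::nat)"] generate_pow_subset[OF a] a by auto
  show "(\<lambda>K. relative_order G K a) ` {K. subgroup K G \<and> K \<subseteq> generate G {a}} \<subseteq> {e. e dvd group.ord G a}"
    using relative_order_dvd_ord[OF _ a] by blast
qed

text \<open>
  For \<open>K = \<langle>a\<^sup>e\<rangle>\<close> and \<open>f\<close> the order of \<open>a\<close> modulo \<open>\<langle>b\<rangle>\<close>, the order of \<open>K \<inter> \<langle>b\<rangle>\<close> is the order of \<open>a\<close>
  divided by \<open>lcm e f\<close>.
\<close>
lemma relative_order_generate_pow_lcm:
  assumes a: "a \<in> carrier G" and b: "b \<in> carrier G" and e: "e dvd group.ord G a"
  shows "group.ord G b * lcm e (relative_order G (generate G {b}) a)
       = relative_order G (generate G {a [^] e}) b * group.ord G a"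
proof -
  let ?K = "generate G {a [^] e}" and ?B = "generate G {b}"
  define f where "f = relative_order G ?B a"
  have ae: "a [^] e \<in> carrier G" using a by simp
  have K: "subgroup ?K G" and B: "subgroup ?B G"
    using ae b by (simp_all add: subgroup_generate_singleton)
  obtain N where N: "group.ord G a = e * N" using e by blast
  have e0: "e > 0" using N ord_pos[OF a] by simp
  define u where "u = lcm e f div e"
  have u: "lcm e f = e * u" unfolding u_def by simp
  have "relative_order G ?B (a [^] e) = u"
  proof (rule relative_order_eqI[OF B ae])
    fix n :: nat
    have "(a [^] e) [^] n \<in> ?B \<longleftrightarrow> f dvd e * n"
      using pow_mem_iff_relative_order_dvd[OF B a] a by (simp add: nat_pow_pow f_def)
    also have "\<dots> \<longleftrightarrow> lcm e f dvd e * n" by simp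
    also have "\<dots> \<longleftrightarrow> u dvd n" using u e0 by simp
    finally show "(a [^] e) [^] n \<in> ?B \<longleftrightarrow> u dvd n" .
  qed
  then have "card (?B \<inter> ?K) * u = group.ord G (a [^] e)"
    using card_Int_generate[OF B ae] by simp
  also have "\<dots> = N" using ord_pow[OF a e] e0 N by simp
  finally have A: "card (?K \<inter> ?B) * lcm e f = group.ord G a"
    using u N by (simp add: Int_commute mult_ac)
  show ?thesis
    unfolding f_def[symmetric] A[symmetric] card_Int_generate[OF K b, symmetric]
    by (simp only: mult_ac)
qed

text \<open>For the subgroup generated by \<open>a [^] e\<close> the index compared with
  \<open>d\<close> equals \<open>group.ord G b * lcm e f / group.ord G a\<close>, written here
  without division. The condition sees \<open>e\<close> only through \<open>lcm e f\<close>, as the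
  cancellation requires.\<close>

lemma sum_moebius_mu_subgroups:
  assumes a: "a \<in> carrier G" and b: "b \<in> carrier G"
  defines "f \<equiv> relative_order G (generate G {b}) a"
  shows "(\<Sum>K | subgroup K G \<and> K \<subseteq> generate G {a} \<and> quot_order G (K <#> generate G {b}) K = d.
            moebius_mu (quot_order G (generate G {a}) K))
       = (\<Sum>e | e dvd group.ord G a \<and> group.ord G b * lcm e f = d * group.ord G a. moebius_mu e)"
proof -
  let ?A = "{e. e dvd group.ord G a \<and> group.ord G b * lcm e f = d * group.ord G a}"
  let ?S = "{K. subgroup K G \<and> K \<subseteq> generate G {a} \<and> quot_order G (K <#> generate G {b}) K = d}"
  let ?h = "\<lambda>e. generate G {a [^] e}"
  have cond: "quot_order G (?h e <#> generate G {b}) (?h e) = d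
      \<longleftrightarrow> group.ord G b * lcm e f = d * group.ord G a" if "e dvd group.ord G a" for e
    using relative_order_generate_pow_lcm[OF a b that] ord_pos[OF a] a b
    by (simp add: quot_order_set_mult_generate subgroup_generate_singleton f_def)
  have "bij_betw ?h ?A ?S"
    using bij_betw_Collect[OF bij_betw_divisors_subgroups[OF a],
        of "\<lambda>K. quot_order G (K <#> generate G {b}) K = d"
           "\<lambda>e. group.ord G b * lcm e f = d * group.ord G a"] cond
    by (simp only: mem_Collect_eq conj_assoc)
  then have "(\<Sum>K\<in>?S. moebius_mu (quot_order G (generate G {a}) K))
      = (\<Sum>e\<in>?A. moebius_mu (quot_order G (generate G {a}) (?h e)))"
    by (rule sum.reindex_bij_betw[symmetric])
  also have "\<dots> = (\<Sum>e\<in>?A. moebius_mu e)"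
  proof (rule sum.cong[OF refl])
    fix e assume "e \<in> ?A"
    then have e: "e dvd group.ord G a" by blast
    have "?h e \<in> {K. subgroup K G \<and> K \<subseteq> generate G {a}}"
      using bij_betwE[OF bij_betw_divisors_subgroups[OF a]] e by blast
    then show "moebius_mu (quot_order G (generate G {a}) (?h e)) = moebius_mu e"
      using quot_order_generate[OF _ a] relative_order_generate_pow[OF a e] by simp
  qed
  finally show ?thesis .
qed

text \<open>Unless \<open>a\<close> lies in the group generated by \<open>b\<close>, f differs from
  1 and the sum cancels. Otherwise \<open>lcm e f = e\<close>, the condition determines
  \<open>e\<close>, and at most one Moebius value remains.\<close>

lemma abs_sum_moebius_mu_subgroups_le:
  assumes a: "a \<in> carrier G" and b: "b \<in> carrier G"
  shows "\<bar>\<Sum>K | subgroup K G \<and> K \<subseteq> generate G {a} \<and> quot_order G (K <#> generate G {b}) K = d.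
            moebius_mu (quot_order G (generate G {a}) K)\<bar> \<le> 1"
proof -
  define f where "f = relative_order G (generate G {b}) a"
  let ?A = "{e. e dvd group.ord G a \<and> group.ord G b * lcm e f = d * group.ord G a}"
  have "\<bar>\<Sum>e\<in>?A. moebius_mu e\<bar> \<le> 1"
  proof (cases "f = 1")
    case False
    have "f dvd group.ord G a"
      unfolding f_def using a b by (intro relative_order_dvd_ord subgroup_generate_singleton)
    then show ?thesis
      using sum_moebius_mu_lcm_eq_0[OF ord_pos[OF a] _ False,
          where Q = "\<lambda>l. group.ord G b * l = d * group.ord G a"] by simp
  next
    case True
    have "?A \<subseteq> {d * group.ord G a div group.ord G b}"
    proof
      fix e assume "e \<in> ?A"
      then have "group.ord G b * e = d * group.ord G a" using True by simp
      then show "e \<in> {d * group.ord G a div group.ord G b}"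
        using ord_pos[OF b] by (metis nonzero_mult_div_cancel_left neq0_conv singleton_iff)
    qed
    then have "?A = {} \<or> ?A = {d * group.ord G a div group.ord G b}" by (rule subset_singletonD)
    then show ?thesis using abs_moebius_mu_le by (elim disjE; simp only: sum.empty sum.insert; simp)
  qed
  then show ?thesis using sum_moebius_mu_subgroups[OF a b] by (simp add: f_def)
qed

text \<open>This makes \<open>N_1\<close> the identity matrix. When f = 1, one cyclic group contains
  the other, and the order of \<open>b\<close> times \<open>e\<close> equals that of
  \<open>a\<close> only for e = 1 and equal orders.\<close>

lemma sum_moebius_mu_subgroups_1:
  assumes a: "a \<in> carrier G" and b: "b \<in> carrier G"
  shows "(\<Sum>K | subgroup K G \<and> K \<subseteq> generate G {a} \<and> quot_order G (K <#> generate G {b}) K = 1.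
            moebius_mu (quot_order G (generate G {a}) K))
       = (if generate G {a} = generate G {b} then 1 else 0)"
proof -
  define f where "f = relative_order G (generate G {b}) a"
  let ?A = "{e. e dvd group.ord G a \<and> group.ord G b * lcm e f = 1 * group.ord G a}"
  have B: "subgroup (generate G {b}) G" using subgroup_generate_singleton[OF b] .
  have f1: "f = 1 \<longleftrightarrow> a \<in> generate G {b}"
    using pow_mem_iff_relative_order_dvd[OF B a, of 1] a by (simp add: f_def)
  have "(\<Sum>e\<in>?A. moebius_mu e) = (if generate G {a} = generate G {b} then 1 else 0)"
  proof (cases "f = 1")
    case False
    have "f dvd group.ord G a"
      unfolding f_def using a b by (intro relative_order_dvd_ord subgroup_generate_singleton)
    moreover have "generate G {a} \<noteq> generate G {b}"
      using False f1 generate.incl[of a "{a}" G] by auto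
    ultimately show ?thesis
      using sum_moebius_mu_lcm_eq_0[OF ord_pos[OF a] _ False,
          where Q = "\<lambda>l. group.ord G b * l = 1 * group.ord G a"] by simp
  next
    case True
    have sub: "generate G {a} \<subseteq> generate G {b}"
      using True f1 B by (intro generate_subgroup_incl) auto
    have finB: "finite (generate G {b})" using finite_subgroup[OF B] .
    have le: "group.ord G a \<le> group.ord G b"
      using card_mono[OF finB sub] a b by (simp add: generate_pow_card)
    have eq: "generate G {a} = generate G {b} \<longleftrightarrow> group.ord G a = group.ord G b"
      using card_subset_eq[OF finB sub] a b by (auto simp: generate_pow_card)
    show ?thesis
    proof (cases "group.ord G a = group.ord G b")
      case True2: True
      have "?A = {1}" using True True2 ord_pos[OF b] by auto
      then show ?thesis using eq True2 by (simp only:) (simp add: moebius_mu_1[unfolded One_nat_def])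
    next
      case False
      have "?A = {}"
      proof (rule ccontr)
        assume "?A \<noteq> {}"
        then obtain e where e: "group.ord G b * e = group.ord G a" using True by auto
        then have "e > 0" using ord_pos[OF a] by (metis mult_0_right neq0_conv)
        then have "group.ord G b \<le> group.ord G b * e" by simp
        then show False using e le False by simp
      qed
      then show ?thesis using eq False by (simp only:) simp
    qed
  qed
  then show ?thesis using sum_moebius_mu_subgroups[OF a b, of 1] by (simp add: f_def)
qed

section \<open>Cyclic subgroups and their sets of generators\<close>

lemma cyclic_subgroups_eq: "cyclic_subgroups G = (\<lambda>g. generate G {g}) ` carrier G"
proof (intro equalityI subsetI)
  fix K assume "K \<in> cyclic_subgroups G"
  then have K: "subgroup K G" and cyc: "cyclic_group (G\<lparr>carrier := K\<rparr>)"
    by (auto simp: cyclic_subgroups_def)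
  from cyc obtain x where x: "x \<in> K"
    and gen: "subgroup_generated (G\<lparr>carrier := K\<rparr>) {x} = G\<lparr>carrier := K\<rparr>"
    by (auto simp: cyclic_group_def)
  have "carrier (subgroup_generated (G\<lparr>carrier := K\<rparr>) {x}) = generate (G\<lparr>carrier := K\<rparr>) {x}"
    using x by (simp add: carrier_subgroup_generated)
  also have "\<dots> = generate G {x}"
    using x K by (intro generate_consistent) auto
  finally have "K = generate G {x}" using gen by simp
  then show "K \<in> (\<lambda>g. generate G {g}) ` carrier G"
    using x subgroup.mem_carrier[OF K] by blast
next
  fix K assume "K \<in> (\<lambda>g. generate G {g}) ` carrier G"
  then obtain g where g: "g \<in> carrier G" and Kg: "K = generate G {g}" by blast
  have K: "subgroup K G" using Kg subgroup_generate_singleton[OF g] by simp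
  have gK: "g \<in> K" using Kg generate.incl[of g "{g}" G] by simp
  have "subgroup_generated (G\<lparr>carrier := K\<rparr>) {g} = G\<lparr>carrier := generate (G\<lparr>carrier := K\<rparr>) {g}\<rparr>"
    using gK by (simp add: subgroup_generated_def)
  also have "\<dots> = G\<lparr>carrier := K\<rparr>"
    using generate_consistent[OF _ K, of "{g}"] gK Kg by simp
  finally have "cyclic_group (G\<lparr>carrier := K\<rparr>)"
    using gK by (auto simp: cyclic_group_def)
  then show "K \<in> cyclic_subgroups G" using K by (simp add: cyclic_subgroups_def)
qed

lemma finite_cyclic_subgroups: "finite (cyclic_subgroups G)"
  using finite_carrier by (simp add: cyclic_subgroups_eq)

lemma subgroup_of_generate_cyclic:
  assumes "subgroup K G" "a \<in> carrier G" "K \<subseteq> generate G {a}"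
  shows "K \<in> cyclic_subgroups G"
  using Int_generate_eq[OF assms(1,2)] assms(2,3)
  by (auto simp: cyclic_subgroups_eq inf.absorb1)

text \<open>The classes are those of the equivalence relation of generating the same subgroup; that
  they partition the group can be read off from this form.\<close>

lemma lattice_classes_eq:
  "lattice_classes G = (\<lambda>g. {h \<in> carrier G. generate G {h} = generate G {g}}) ` carrier G"
proof -
  have "{h \<in> generate G {g}. generate G {h} = generate G {g}}
      = {h \<in> carrier G. generate G {h} = generate G {g}}" if "g \<in> carrier G" for g
    using that subgroup.mem_carrier[OF subgroup_generate_singleton[OF that]] generate.incl[of _ "{_}" G]
    by auto
  then show ?thesis by (auto simp: lattice_classes_def cyclic_subgroups_eq)
qed

lemma finite_lattice_classes: "finite (lattice_classes G)"
  using finite_carrier by (simp add: lattice_classes_eq)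

lemma lattice_classes_nonempty: "lattice_classes G \<noteq> {}"
  by (auto simp: lattice_classes_eq)

lemma Union_lattice_classes: "\<Union> (lattice_classes G) = carrier G"
  by (auto simp: lattice_classes_eq)

lemma disjoint_lattice_classes:
  "\<lbrakk>A \<in> lattice_classes G; A' \<in> lattice_classes G; g \<in> A; g \<in> A'\<rbrakk> \<Longrightarrow> A = A'"
  by (auto simp: lattice_classes_eq)

lemma ex_mem_lattice_class: "A \<in> lattice_classes G \<Longrightarrow> \<exists>g. g \<in> A \<and> g \<in> carrier G"
  by (auto simp: lattice_classes_eq)

lemma generate_lattice_class:
  assumes A: "A \<in> lattice_classes G" and g: "g \<in> A"
  shows "generate G A = generate G {g}"
proof
  have gc: "g \<in> carrier G" using A g Union_lattice_classes by blast
  have "h \<in> generate G {g}" if "h \<in> A" for h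
    using A g that generate.incl[of h "{h}" G] by (auto simp: lattice_classes_eq)
  then show "generate G A \<subseteq> generate G {g}"
    using subgroup_generate_singleton[OF gc] by (intro generate_subgroup_incl) auto
  show "generate G {g} \<subseteq> generate G A"
    using g by (intro mono_generate) simp
qed

lemma generate_lattice_class_inj:
  assumes "A \<in> lattice_classes G" "A' \<in> lattice_classes G"
  shows "generate G A = generate G A' \<longleftrightarrow> A = A'"
proof
  obtain g g' where g: "g \<in> A" "g \<in> carrier G" and g': "g' \<in> A'" "g' \<in> carrier G"
    using ex_mem_lattice_class assms by blast
  assume "generate G A = generate G A'"
  then have "generate G {g} = generate G {g'}"
    using generate_lattice_class assms g g' by simp
  then show "A = A'"
    using assms g g' by (auto simp: lattice_classes_eq)
qed simp

end

section \<open>Tails of zeta functions\<close>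

text \<open>The derivative of the difference is y (1 - 2y) / (1 - y), nonnegative up to 1/2. The
  coefficient 1 of the square lets it be charged to a single integer later.\<close>

lemma minus_ln_one_minus_le:
  fixes x :: real
  assumes "0 \<le> x" "x \<le> 1 / 2"
  shows "- ln (1 - x) \<le> x + x\<^sup>2"
proof -
  let ?h = "\<lambda>x::real. ln (1 - x) + x + x\<^sup>2"
  have "?h 0 \<le> ?h x"
  proof (rule DERIV_nonneg_imp_nondecreasing[OF assms(1)])
    fix y :: real assume y: "0 \<le> y" "y \<le> x"
    have "(?h has_real_derivative (- 1 / (1 - y) + 1 + 2 * y)) (at y)"
      using y assms by (auto intro!: derivative_eq_intros)
    moreover have "- 1 / (1 - y) + 1 + 2 * y = y * (1 - 2 * y) / (1 - y)"
      using y assms by (simp add: field_simps)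
    moreover have "0 \<le> y * (1 - 2 * y) / (1 - y)"
      using y assms by simp
    ultimately show "\<exists>z. (?h has_real_derivative z) (at y) \<and> 0 \<le> z" by auto
  qed
  then show ?thesis by simp
qed

text \<open>This is P^(-f) plus the integral of x^(-f) from P to infinity, the usual majorant of the
  sum of n^(-f) over n \<ge> P.\<close>

definition zeta_tail_bound :: "real \<Rightarrow> real \<Rightarrow> real" where
  "zeta_tail_bound P f = (1 + P / (f - 1)) / P powr f"

lemma powr_step_le:
  fixes f x :: real
  assumes "f > 1" "x > 0"
  shows "(x + 1) powr (- f) \<le> (x powr (1 - f) - (x + 1) powr (1 - f)) / (f - 1)"
proof -
  have "\<exists>z. x < z \<and> z < x + 1 \<and> (x + 1) powr (1 - f) - x powr (1 - f) = (x + 1 - x) * ((1 - f) * z powr (1 - f - 1))"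
    using assms by (intro MVT2) (auto intro!: derivative_eq_intros)
  then obtain z where z: "x < z" "z < x + 1"
    and eq: "x powr (1 - f) - (x + 1) powr (1 - f) = (f - 1) * z powr (- f)"
    by (auto simp: algebra_simps)
  have "(x + 1) powr (- f) \<le> z powr (- f)"
    using z assms by (intro powr_mono2') auto
  then show ?thesis unfolding eq using assms by simp
qed

lemma sum_powr_tail_le:
  fixes f P :: real and M :: "nat set"
  assumes f: "f > 1" and P: "P \<ge> 2" and fin: "finite M" and ge: "\<And>n. n \<in> M \<Longrightarrow> P \<le> real n"
  shows "(\<Sum>n\<in>M. real n powr (- f)) \<le> zeta_tail_bound P f"
proof -
  \<comment> \<open>The first integer not below \<open>P\<close>: the telescoping starts there, and
    the result passes to \<open>P\<close> because both of its terms decrease.\<close>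
  define N where "N = nat \<lceil>P\<rceil>"
  have N: "P \<le> real N" "N > 0" using P by (auto simp: N_def)
  have NM: "N \<le> n" if "n \<in> M" for n using ge[OF that] by (simp add: N_def nat_le_iff ceiling_le_iff)
  have step: "(\<Sum>n\<in>{N..N + k}. real n powr (- f))
      \<le> real N powr (- f) + (real N powr (1 - f) - real (N + k) powr (1 - f)) / (f - 1)" for k
  proof (induction k)
    case 0
    then show ?case by simp
  next
    case (Suc k)
    have "(\<Sum>n\<in>{N..N + Suc k}. real n powr (- f))
        = (\<Sum>n\<in>{N..N + k}. real n powr (- f)) + real (N + Suc k) powr (- f)" by simp
    also have "\<dots> \<le> real N powr (- f) + (real N powr (1 - f) - real (N + k) powr (1 - f)) / (f - 1)
        + (real (N + k) powr (1 - f) - real (N + Suc k) powr (1 - f)) / (f - 1)"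
      using powr_step_le[OF f, of "real (N + k)"] N Suc by (intro add_mono) (simp_all add: add_ac)
    also have "\<dots> = real N powr (- f) + (real N powr (1 - f) - real (N + Suc k) powr (1 - f)) / (f - 1)"
      by (simp add: diff_divide_distrib)
    finally show ?case .
  qed
  define k where "k = Max (insert 0 M)"
  have "n \<le> k" if "n \<in> M" for n using fin that by (simp add: k_def)
  then have "M \<subseteq> {N..N + k}" using NM by (auto intro!: trans_le_add2)
  then have "(\<Sum>n\<in>M. real n powr (- f)) \<le> (\<Sum>n\<in>{N..N + k}. real n powr (- f))"
    by (intro sum_mono2) auto
  also have "\<dots> \<le> real N powr (- f) + (real N powr (1 - f) - real (N + k) powr (1 - f)) / (f - 1)"
    by (rule step)
  also have "\<dots> \<le> real N powr (- f) + real N powr (1 - f) / (f - 1)"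
    using f by (intro add_left_mono divide_right_mono) auto
  also have "\<dots> \<le> P powr (- f) + P powr (1 - f) / (f - 1)"
    using f P N by (intro add_mono divide_right_mono powr_mono2') auto
  also have "\<dots> = zeta_tail_bound P f"
  proof -
    have "P powr (1 - f) = P / P powr f" using P by (simp add: powr_diff)
    moreover have "P powr (- f) = 1 / P powr f" by (simp add: powr_minus_divide)
    ultimately show ?thesis by (simp add: zeta_tail_bound_def add_divide_distrib)
  qed
  finally show ?thesis .
qed

section \<open>Logarithms of Euler products\<close>

text \<open>Taking logarithms factor by factor turns Euler products into series of nonnegative
  terms, so residue conditions become restrictions of one summable series.\<close>

definition prime_log :: "real \<Rightarrow> real \<Rightarrow> nat \<Rightarrow> real" where
  "prime_log P f p = (if prime p \<and> P \<le> real p then - ln (1 - real p powr (- f)) else 0)"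

lemma powr_minus_le_half:
  fixes x f :: real
  assumes "x \<ge> 2" "f > 1"
  shows "x powr (- f) \<le> 1 / 2"
proof -
  have "x powr (- f) \<le> x powr (- 1)" using assms by (intro powr_mono) auto
  also have "\<dots> \<le> 2 powr (- 1)" using assms by (intro powr_mono2') auto
  finally show ?thesis by (simp add: powr_minus_divide)
qed

lemma prime_log_nonneg:
  assumes "f > 1" "P \<ge> 2"
  shows "prime_log P f p \<ge> 0"
proof -
  have "ln (1 - real p powr (- f)) \<le> 0" if "prime p"
    using powr_minus_le_half[of "real p" f] assms prime_ge_2_nat[OF that] by simp
  then show ?thesis by (simp add: prime_log_def)
qed

text \<open>
  The terms \<open>x\<close> and \<open>x\<^sup>2\<close> of the bound \<open>- ln (1 - x) \<le> x + x\<^sup>2\<close> at \<open>x = p\<^sup>-\<^sup>f\<close> belong to the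
  integers \<open>p\<close> and \<open>p\<^sup>2\<close>, and no integer is hit twice.
\<close>
lemma sum_prime_log_le:
  assumes f: "f > 1" and P: "P \<ge> 2" and F: "finite F"
  shows "sum (prime_log P f) F \<le> zeta_tail_bound P f"
proof -
  define S where "S = {p \<in> F. prime p \<and> P \<le> real p}"
  have finS: "finite S" using F by (simp add: S_def)
  have inj: "inj_on (\<lambda>p::nat. p\<^sup>2) S" by (simp add: inj_on_def)
  have disj: "S \<inter> (\<lambda>p. p\<^sup>2) ` S = {}"
  proof -
    have "\<not> prime (p\<^sup>2)" for p :: nat by (simp add: prime_power_iff)
    then show ?thesis by (auto simp: S_def)
  qed
  have "sum (prime_log P f) F = (\<Sum>p\<in>S. - ln (1 - real p powr (- f)))"
    using F by (simp add: prime_log_def S_def sum.If_cases Int_def conj_commute)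
  also have "\<dots> \<le> (\<Sum>p\<in>S. real p powr (- f) + real (p\<^sup>2) powr (- f))"
  proof (rule sum_mono)
    fix p assume p: "p \<in> S"
    then have p2: "real p \<ge> 2" using P by (simp add: S_def)
    have "real (p\<^sup>2) powr (- f) = (real p powr (- f))\<^sup>2"
      using p2 by (simp add: power2_eq_square powr_mult)
    then show "- ln (1 - real p powr (- f)) \<le> real p powr (- f) + real (p\<^sup>2) powr (- f)"
      using minus_ln_one_minus_le[of "real p powr (- f)"] powr_minus_le_half[OF p2 f] by simp
  qed
  also have "\<dots> = (\<Sum>n\<in>S. real n powr (- f)) + (\<Sum>n\<in>(\<lambda>p. p\<^sup>2) ` S. real n powr (- f))"
    by (simp add: sum.distrib sum.reindex[OF inj])
  also have "\<dots> = (\<Sum>n\<in>S \<union> (\<lambda>p. p\<^sup>2) ` S. real n powr (- f))"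
    using finS disj by (simp add: sum.union_disjoint)
  also have "\<dots> \<le> zeta_tail_bound P f"
  proof (rule sum_powr_tail_le[OF f P])
    fix n assume "n \<in> S \<union> (\<lambda>p. p\<^sup>2) ` S"
    then obtain p where p: "p \<in> S" "n = p \<or> n = p\<^sup>2" by auto
    have "p \<le> p\<^sup>2" by (simp add: power2_eq_square)
    then have "p \<le> n" using p by auto
    then show "P \<le> real n" using p by (simp add: S_def)
  qed (use finS in simp)
  finally show ?thesis .
qed

lemma summable_prime_log:
  assumes "f > 1" "P \<ge> 2"
  shows "summable (prime_log P f)"
  by (rule summableI_nonneg_bounded[where x = "zeta_tail_bound P f"])
    (use assms prime_log_nonneg sum_prime_log_le in auto)

lemma suminf_prime_log_le:
  assumes "f > 1" "P \<ge> 2"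
  shows "suminf (prime_log P f) \<le> zeta_tail_bound P f"
  using assms by (intro suminf_le_const summable_prime_log sum_prime_log_le) auto

lemma summable_prime_log_If:
  assumes "f > 1" "P \<ge> 2"
  shows "summable (\<lambda>p. if Q p then prime_log P f p else 0)"
  by (rule summable_comparison_test'[OF summable_prime_log[OF assms], where N = 0])
    (use prime_log_nonneg[OF assms] in auto)

lemma ln_zeta_P_eq:
  assumes "f > 1" "P \<ge> 2"
  shows "ln (zeta_P P q f A) = (\<Sum>p. if int p mod int q \<in> A then prime_log P f p else 0)"
proof -
  let ?v = "\<lambda>p. if int p mod int q \<in> A then prime_log P f p else 0"
  have "zeta_P P q f A = (\<Prod>p. exp (?v p))"
    unfolding zeta_P_def
  proof (rule prodinf_cong)
    fix p :: nat
    have "1 - real p powr (- f) > 0" if "prime p"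
      using powr_minus_le_half[of "real p" f] assms prime_ge_2_nat[OF that] by simp
    then show "(if prime p \<and> P \<le> real p \<and> int p mod int q \<in> A
        then inverse (1 - real p powr (- f)) else 1) = exp (?v p)"
      by (simp add: prime_log_def exp_minus)
  qed
  also have "\<dots> = exp (suminf ?v)"
    by (rule prodinf_exp[OF summable_prime_log_If[OF assms]])
  finally show ?thesis by simp
qed

lemma V_vec_nonneg:
  assumes "real t * s > 1" "P \<ge> 2"
  shows "V_vec P q s t A \<ge> 0"
  unfolding V_vec_def ln_zeta_P_eq[OF assms]
  using prime_log_nonneg[OF assms] by (intro suminf_nonneg summable_prime_log_If assms) auto

lemma finite_comm_group_unit_group:
  assumes "q > 1"
  shows "finite_comm_group (unit_group q)"
proof -
  interpret residues "int q" "residue_ring (int q)"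
    using assms by unfold_locales auto
  show ?thesis
    unfolding unit_group_def
    by (intro finite_comm_group.intro units_comm_group finite_comm_group_axioms.intro)
      (simp add: units_of_carrier)
qed

lemma mod_mem_unit_group_iff:
  assumes "q > 1"
  shows "int n mod int q \<in> carrier (unit_group q) \<longleftrightarrow> coprime n q"
proof -
  interpret residues "int q" "residue_ring (int q)"
    using assms by unfold_locales auto
  have "coprime (int n mod int q) (int q) \<longleftrightarrow> coprime n q"
    by (metis coprime_int_iff coprime_mod_left_iff assms less_not_refl2 of_nat_0_eq_iff not_one_less_zero)
  moreover have "int n mod int q \<in> Units (residue_ring (int q))"
    if "coprime (int n mod int q) (int q)"
    using mod_in_res_units[of "int n mod int q"] that assms by simp
  ultimately show ?thesis
    by (auto simp: unit_group_def units_of_carrier res_units_eq)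
qed

section \<open>Iterating the recursion\<close>

lemma sum_lists_prod_list:
  fixes h :: "'a \<Rightarrow> real"
  assumes "finite D"
  shows "(\<Sum>ds | set ds \<subseteq> D \<and> length ds = n. prod_list (map h ds)) = (\<Sum>d\<in>D. h d) ^ n"
proof (induction n)
  case 0
  have "{ds. set ds \<subseteq> D \<and> length ds = 0} = {[]}" by auto
  then show ?case by simp
next
  case (Suc n)
  let ?L = "{ds. set ds \<subseteq> D \<and> length ds = n}"
  have inj: "inj_on (\<lambda>(ds, d). d # ds) (?L \<times> D)" by (auto simp: inj_on_def)
  have "(\<Sum>ds | set ds \<subseteq> D \<and> length ds = Suc n. prod_list (map h ds))
      = (\<Sum>(ds, d)\<in>?L \<times> D. prod_list (map h ds) * h d)"
    unfolding lists_length_Suc_eq sum.reindex[OF inj]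
    by (intro sum.cong refl) (auto simp: mult.commute)
  also have "\<dots> = (\<Sum>ds\<in>?L. prod_list (map h ds)) * (\<Sum>d\<in>D. h d)"
    by (simp add: sum.cartesian_product sum_product)
  finally show ?case using Suc by simp
qed

text \<open>Bernoulli's inequality for the product of the \<open>d / 2\<close>.\<close>
lemma prod_list_ge:
  assumes "\<And>d. d \<in> set ds \<Longrightarrow> d \<ge> (2::nat)"
  shows "2 ^ length ds * (2 + sum_list (map (\<lambda>d. d - 2) ds)) \<le> 2 * prod_list ds"
  using assms
proof (induction ds)
  case Nil
  then show ?case by simp
next
  case (Cons d ds)
  define S where "S = sum_list (map (\<lambda>d. d - 2) ds)"
  obtain e where d: "d = e + 2" using Cons.prems[of d] by (metis le_add_diff_inverse2 list.set_intros(1))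
  have IH: "2 ^ length ds * (2 + S) \<le> 2 * prod_list ds"
    unfolding S_def using Cons by simp
  have "2 ^ length (d # ds) * (2 + sum_list (map (\<lambda>d. d - 2) (d # ds)))
      = 2 ^ length ds * (4 + 2 * e + 2 * S)"
    by (simp add: d S_def algebra_simps)
  also have "\<dots> \<le> 2 ^ length ds * ((e + 2) * (2 + S))"
    by (intro mult_left_mono) (auto simp: algebra_simps)
  also have "\<dots> = (e + 2) * (2 ^ length ds * (2 + S))" by (simp only: mult_ac)
  also have "\<dots> \<le> (e + 2) * (2 * prod_list ds)"
    using IH by (rule mult_left_mono) simp
  finally show ?case by (simp add: d mult_ac)
qed

corollary prod_list_ge_power:
  assumes "\<And>d. d \<in> set ds \<Longrightarrow> d \<ge> (2::nat)"
  shows "2 ^ length ds \<le> prod_list ds"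
proof -
  have "2 * 2 ^ length ds \<le> 2 ^ length ds * (2 + sum_list (map (\<lambda>d. d - 2) ds))"
    by (simp add: algebra_simps)
  also have "\<dots> \<le> 2 * prod_list ds" by (rule prod_list_ge[OF assms])
  finally show ?thesis by simp
qed

text \<open>The exponents are distinct, so the full geometric series of ratio 1/4 is a majorant,
  however many elements \<open>D\<close> has.\<close>

lemma sum_quarter_power_le:
  assumes "finite D" "\<And>d. d \<in> D \<Longrightarrow> d \<ge> (2::nat)"
  shows "(\<Sum>d\<in>D. (1 / 4 :: real) ^ (d - 2)) \<le> 4 / 3"
proof -
  \<comment> \<open>Truncated subtraction is injective here because every element is at least
    2.\<close>
  have inj: "inj_on (\<lambda>d. d - 2) D"
  proof (rule inj_onI)
    fix x y assume "x \<in> D" "y \<in> D" "x - 2 = y - 2"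
    then show "x = y" using assms(2)[of x] assms(2)[of y] by linarith
  qed
  have "(\<Sum>d\<in>D. (1 / 4 :: real) ^ (d - 2)) = (\<Sum>k\<in>(\<lambda>d. d - 2) ` D. (1 / 4) ^ k)"
    by (simp add: sum.reindex[OF inj])
  also have "\<dots> \<le> (\<Sum>k. (1 / 4) ^ k)"
    using assms(1) by (intro sum_le_suminf summable_geometric) auto
  also have "\<dots> = 4 / 3" by (subst suminf_geometric) auto
  finally show ?thesis .
qed

text \<open>The iteration uses only this linear recursion. In the application \<open>J\<close>
  consists of the classes, \<open>D\<close> of the divisors other than 1, \<open>M d\<close> is
  \<open>N_d / d\<close>, and \<open>T t\<close> is the image of the vector \<open>\<Gamma>\<close>
  at \<open>t\<close> under the matrix \<open>M1_inv\<close>.\<close>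

locale matrix_recursion =
  fixes J :: "'i set" and D :: "nat set"
    and M :: "nat \<Rightarrow> 'i \<Rightarrow> 'i \<Rightarrow> real" and V T :: "nat \<Rightarrow> 'i \<Rightarrow> real"
  assumes finite_index: "finite J" and finite_factors: "finite D"
    and factor_ge_2: "\<And>d. d \<in> D \<Longrightarrow> d \<ge> 2"
    and recursion: "\<And>t i. t > 0 \<Longrightarrow> i \<in> J \<Longrightarrow>
      V t i = T t i - (\<Sum>d\<in>D. mat_vec J (M d) (V (t * d)) i)"
begin

definition apply_all :: "nat list \<Rightarrow> ('i \<Rightarrow> real) \<Rightarrow> 'i \<Rightarrow> real" where
  "apply_all ds = foldr (\<lambda>d. mat_vec J (M d)) ds"

definition short_tuples :: "nat \<Rightarrow> nat \<Rightarrow> nat list set" where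
  "short_tuples v b = {ds. set ds \<subseteq> D \<and> length ds = v \<and> prod_list ds \<le> b}"

text \<open>The tuples at which the expansion stops: they arise by appending one factor to a short
  tuple and are the first to exceed \<open>b\<close>.\<close>

definition boundary_tuples :: "nat \<Rightarrow> nat \<Rightarrow> nat list set" where
  "boundary_tuples v b =
     {ds. set ds \<subseteq> D \<and> length ds = v \<and> prod_list (butlast ds) \<le> b \<and> prod_list ds > b}"

lemma apply_all_simps [simp]:
  "apply_all [] w = w"
  "apply_all (d # ds) w = mat_vec J (M d) (apply_all ds w)"
  "apply_all (ds @ [d]) w = apply_all ds (mat_vec J (M d) w)"
  by (simp_all add: apply_all_def)

lemma apply_all_cong:
  assumes "\<And>j. j \<in> J \<Longrightarrow> w j = w' j" "i \<in> J"
  shows "apply_all ds w i = apply_all ds w' i"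
  using assms(2) by (induction ds arbitrary: i) (auto simp: assms(1) mat_vec_def)

lemma apply_all_diff_sum:
  "apply_all ds (\<lambda>i. u i - (\<Sum>x\<in>X. w x i)) i = apply_all ds u i - (\<Sum>x\<in>X. apply_all ds (w x) i)"
proof (induction ds arbitrary: i)
  case Nil
  then show ?case by simp
next
  case (Cons d ds)
  have "apply_all (d # ds) (\<lambda>i. u i - (\<Sum>x\<in>X. w x i)) i
      = (\<Sum>j\<in>J. M d i j * apply_all ds u j - (\<Sum>x\<in>X. M d i j * apply_all ds (w x) j))"
    by (simp add: mat_vec_def Cons right_diff_distrib sum_distrib_left)
  also have "\<dots> = apply_all (d # ds) u i - (\<Sum>x\<in>X. apply_all (d # ds) (w x) i)"
    unfolding sum_subtractf by (subst sum.swap) (simp add: mat_vec_def)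
  finally show ?case .
qed

lemma prod_list_pos: "set ds \<subseteq> D \<Longrightarrow> prod_list ds > 0"
  using factor_ge_2 by (induction ds) fastforce+

lemma finite_tuples: "finite {ds. set ds \<subseteq> D \<and> length ds = v}"
  using finite_lists_length_eq[OF finite_factors] .

lemma finite_short_tuples: "finite (short_tuples v b)"
  by (rule finite_subset[OF _ finite_tuples[of v]]) (auto simp: short_tuples_def)

lemma finite_boundary_tuples: "finite (boundary_tuples v b)"
  by (rule finite_subset[OF _ finite_tuples[of v]]) (auto simp: boundary_tuples_def)

text \<open>One use of the recursion appends one more factor to each short tuple. The new tuples are
  those whose \<open>butlast\<close> is short; they are either short again or on the
  boundary.\<close>

lemma sum_short_tuples_expand:
  assumes i: "i \<in> J"
  shows "(\<Sum>ds\<in>short_tuples v b. apply_all ds (V (prod_list ds)) i)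
       = (\<Sum>ds\<in>short_tuples v b. apply_all ds (T (prod_list ds)) i)
         - (\<Sum>ds\<in>short_tuples (Suc v) b \<union> boundary_tuples (Suc v) b. apply_all ds (V (prod_list ds)) i)"
proof -
  let ?X = "short_tuples v b" and ?Y = "short_tuples (Suc v) b \<union> boundary_tuples (Suc v) b"
  have Y: "?Y = {ds. set ds \<subseteq> D \<and> length ds = Suc v \<and> prod_list (butlast ds) \<le> b}"
  proof -
    have "prod_list (butlast ds) \<le> b"
      if ds: "set ds \<subseteq> D" "length ds = Suc v" "prod_list ds \<le> b" for ds
    proof -
      obtain us d where us: "ds = us @ [d]" using ds(2) by (metis length_Suc_conv_rev)
      have "d \<ge> 2" using factor_ge_2 ds us by simp
      then have "prod_list us * 1 \<le> prod_list us * d" by (intro mult_le_mono2) simp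
      also have "\<dots> \<le> b" using ds(3) us by simp
      finally show ?thesis using us by simp
    qed
    then show ?thesis by (auto simp: short_tuples_def boundary_tuples_def)
  qed
  have bij: "bij_betw (\<lambda>(ds, d). ds @ [d]) (?X \<times> D) ?Y"
    unfolding Y
  proof (rule bij_betw_byWitness[where f' = "\<lambda>ds. (butlast ds, last ds)"])
    show "(\<lambda>ds. (butlast ds, last ds)) `
        {ds. set ds \<subseteq> D \<and> length ds = Suc v \<and> prod_list (butlast ds) \<le> b} \<subseteq> ?X \<times> D"
    proof (rule image_subsetI)
      fix ds assume ds: "ds \<in> {ds. set ds \<subseteq> D \<and> length ds = Suc v \<and> prod_list (butlast ds) \<le> b}"
      then obtain us d where "ds = us @ [d]" by (auto simp: length_Suc_conv_rev)
      then show "(butlast ds, last ds) \<in> ?X \<times> D" using ds by (auto simp: short_tuples_def)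
    qed
  qed (auto simp: short_tuples_def length_Suc_conv_rev)
  have "apply_all ds (V (prod_list ds)) i = apply_all ds (T (prod_list ds)) i
      - (\<Sum>d\<in>D. apply_all (ds @ [d]) (V (prod_list (ds @ [d]))) i)" if "ds \<in> ?X" for ds
  proof -
    have "apply_all ds (V (prod_list ds)) i
        = apply_all ds (\<lambda>i. T (prod_list ds) i - (\<Sum>d\<in>D. mat_vec J (M d) (V (prod_list ds * d)) i)) i"
      using that recursion[OF prod_list_pos] by (intro apply_all_cong i) (simp add: short_tuples_def)
    also have "\<dots> = apply_all ds (T (prod_list ds)) i
      - (\<Sum>d\<in>D. apply_all ds (mat_vec J (M d) (V (prod_list ds * d))) i)"
      by (rule apply_all_diff_sum)
    finally show ?thesis by simp
  qed
  then have "(\<Sum>ds\<in>?X. apply_all ds (V (prod_list ds)) i)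
      = (\<Sum>ds\<in>?X. apply_all ds (T (prod_list ds)) i)
        - (\<Sum>ds\<in>?X. \<Sum>d\<in>D. apply_all (ds @ [d]) (V (prod_list (ds @ [d]))) i)"
    by (simp only: sum_subtractf cong: sum.cong)
  also have "(\<Sum>ds\<in>?X. \<Sum>d\<in>D. apply_all (ds @ [d]) (V (prod_list (ds @ [d]))) i)
      = (\<Sum>ds\<in>?Y. apply_all ds (V (prod_list ds)) i)"
    unfolding sum.cartesian_product sum.reindex_bij_betw[OF bij, symmetric]
    by (simp add: case_prod_unfold)
  finally show ?thesis .
qed

lemma sum_short_boundary_tuples:
  "(\<Sum>ds\<in>short_tuples v b \<union> boundary_tuples v b. F ds)
     = (\<Sum>ds\<in>short_tuples v b. F ds) + (\<Sum>ds\<in>boundary_tuples v b. F ds :: real)"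
  by (intro sum.union_disjoint finite_short_tuples finite_boundary_tuples)
    (auto simp: short_tuples_def boundary_tuples_def)

text \<open>Only short tuples are expanded further, while boundary tuples of length v are left with
  sign \<open>(- 1) ^ v\<close>. Those of the last length stay together with the short ones, since
  at length r both admit the same estimate.\<close>

lemma iterated_recursion:
  assumes i: "i \<in> J" and b: "b \<ge> 1"
  defines "W \<equiv> \<lambda>ds. apply_all ds (V (prod_list ds)) i"
  shows "V 1 i - (\<Sum>v\<le>n. (- 1) ^ v * (\<Sum>ds\<in>short_tuples v b. apply_all ds (T (prod_list ds)) i))
       = - ((- 1) ^ n) * (\<Sum>ds\<in>short_tuples (Suc n) b \<union> boundary_tuples (Suc n) b. W ds)
         + (\<Sum>v\<in>{1..n}. (- 1) ^ v * (\<Sum>ds\<in>boundary_tuples v b. W ds))"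
proof (induction n)
  case 0
  have "short_tuples 0 b = {[]}" using b by (auto simp: short_tuples_def)
  then show ?case using sum_short_tuples_expand[OF i, of 0 b] by (simp add: W_def)
next
  case (Suc n)
  define S where "S v = (\<Sum>ds\<in>short_tuples v b. W ds)" for v
  define Z where "Z v = (\<Sum>ds\<in>boundary_tuples v b. W ds)" for v
  define R where "R v = (\<Sum>ds\<in>short_tuples v b \<union> boundary_tuples v b. W ds)" for v
  define t where "t v = (\<Sum>ds\<in>short_tuples v b. apply_all ds (T (prod_list ds)) i)" for v
  have S: "S (Suc n) = t (Suc n) - R (Suc (Suc n))"
    using sum_short_tuples_expand[OF i, of "Suc n" b] by (simp add: S_def t_def R_def W_def)
  have "R (Suc n) = S (Suc n) + Z (Suc n)"
    unfolding S_def Z_def R_def by (rule sum_short_boundary_tuples)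
  \<comment> \<open>The short part of the remainder is expanded once more, the boundary part
    \<open>Z\<close> is set aside.\<close>
  then have R: "R (Suc n) = t (Suc n) - R (Suc (Suc n)) + Z (Suc n)" using S by simp
  have "V 1 i - (\<Sum>v\<le>n. (- 1) ^ v * t v)
      = - ((- 1) ^ n) * R (Suc n) + (\<Sum>v\<in>{1..n}. (- 1) ^ v * Z v)"
    using Suc.IH by (simp add: t_def R_def Z_def)
  then have "V 1 i - (\<Sum>v\<le>Suc n. (- 1) ^ v * t v)
      = - ((- 1) ^ Suc n) * R (Suc (Suc n)) + (\<Sum>v\<in>{1..Suc n}. (- 1) ^ v * Z v)"
    unfolding R by (simp add: algebra_simps)
  then show ?case by (simp only: t_def R_def Z_def)
qed

end

section \<open>Estimating the remainder\<close>

text \<open>\<open>E t\<close> stands for the zeta tail at argument t s. Bounding the sum of the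
  entries of \<open>V t\<close>, not only their maximum, is what saves a factor
  \<open>card J\<close>.\<close>

locale bounded_matrix_recursion = matrix_recursion +
  fixes E :: "nat \<Rightarrow> real"
  assumes index_nonempty: "J \<noteq> {}"
    and entry_le: "\<And>d i j. d \<in> D \<Longrightarrow> i \<in> J \<Longrightarrow> j \<in> J \<Longrightarrow> \<bar>M d i j\<bar> \<le> 1 / real d"
    and V_nonneg: "\<And>t j. t > 0 \<Longrightarrow> j \<in> J \<Longrightarrow> V t j \<ge> 0"
    and sum_V_le: "\<And>t. t > 0 \<Longrightarrow> (\<Sum>j\<in>J. V t j) \<le> E t"
    and E_decay: "\<And>t k. t > 0 \<Longrightarrow> E (t + k) \<le> E t * (1 / 2) ^ k"
begin

lemma E_nonneg: "t > 0 \<Longrightarrow> E t \<ge> 0"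
  using sum_V_le[of t] sum_nonneg[of J "V t"] V_nonneg[of t] by fastforce

lemma card_index_ge_1: "real (card J) \<ge> 1"
  using index_nonempty finite_index by (simp add: Suc_le_eq card_gt_0_iff)

lemma abs_apply_all_le:
  assumes "\<And>j. j \<in> J \<Longrightarrow> \<bar>w j\<bar> \<le> c" "c \<ge> 0" "set ds \<subseteq> D" "i \<in> J"
  shows "\<bar>apply_all ds w i\<bar> \<le> real (card J) ^ length ds / real (prod_list ds) * c"
  using assms(3,4)
proof (induction ds arbitrary: i)
  case Nil
  then show ?case using assms(1) by simp
next
  case (Cons d ds)
  let ?c = "real (card J) ^ length ds / real (prod_list ds) * c"
  have "\<bar>apply_all (d # ds) w i\<bar> \<le> (\<Sum>j\<in>J. \<bar>M d i j * apply_all ds w j\<bar>)"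
    unfolding apply_all_simps mat_vec_def by (rule sum_abs)
  also have "\<dots> \<le> (\<Sum>j\<in>J. 1 / real d * ?c)"
    unfolding abs_mult using Cons entry_le by (intro sum_mono mult_mono) auto
  also have "\<dots> = real (card J) ^ length (d # ds) / real (prod_list (d # ds)) * c"
    by simp
  finally show ?case .
qed

text \<open>The innermost matrix acts on a vector of small sum, so it costs no factor \<open>card J\<close>.\<close>
lemma abs_apply_all_V_le:
  assumes ds: "set ds \<subseteq> D" "length ds = Suc n" and i: "i \<in> J" and t: "t > 0"
  shows "\<bar>apply_all ds (V t) i\<bar> \<le> real (card J) ^ n / real (prod_list ds) * E t"
proof -
  obtain us d where us: "ds = us @ [d]" using ds(2) by (metis length_Suc_conv_rev)
  have d: "d \<in> D" "set us \<subseteq> D" "length us = n" using ds us by auto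
  have "\<bar>mat_vec J (M d) (V t) j\<bar> \<le> 1 / real d * E t" if j: "j \<in> J" for j
  proof -
    have "\<bar>mat_vec J (M d) (V t) j\<bar> \<le> (\<Sum>k\<in>J. \<bar>M d j k * V t k\<bar>)"
      unfolding mat_vec_def by (rule sum_abs)
    also have "\<dots> \<le> (\<Sum>k\<in>J. 1 / real d * V t k)"
      unfolding abs_mult using entry_le[OF d(1) j] V_nonneg[OF t] by (intro sum_mono mult_mono) auto
    also have "\<dots> \<le> 1 / real d * E t"
      unfolding sum_distrib_left[symmetric] using sum_V_le[OF t] by (intro mult_left_mono) auto
    finally show ?thesis .
  qed
  from abs_apply_all_le[OF this _ d(2) i] show ?thesis
    using E_nonneg[OF t] d(3) by (simp add: us)
qed

lemma E_antimono: "0 < t \<Longrightarrow> t \<le> u \<Longrightarrow> E u \<le> E t"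
proof -
  assume t: "0 < t" "t \<le> u"
  have "E u \<le> E t * (1 / 2) ^ (u - t)" using E_decay[OF t(1), of "u - t"] t by simp
  also have "\<dots> \<le> E t * 1" using E_nonneg[OF t(1)] by (intro mult_left_mono power_le_one) auto
  finally show ?thesis by simp
qed

text \<open>Since 2^r \<ge> 4, the Bernoulli estimate puts the product at least 2 S above 2^r, with
  S the sum of the d - 2. Each unit halves \<open>E\<close>, so each factor d contributes
  (1/4)^(d-2).\<close>

lemma E_prod_list_le:
  assumes ds: "set ds \<subseteq> D" "length ds = r" and r: "r \<ge> 2"
  shows "E (prod_list ds) \<le> E (2 ^ r) * prod_list (map (\<lambda>d. (1 / 4) ^ (d - 2)) ds)"
proof -
  define S where "S = sum_list (map (\<lambda>d. d - 2) ds)"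
  have "2 ^ r * (2 + S) \<le> 2 * prod_list ds"
    unfolding S_def using prod_list_ge[of ds] ds factor_ge_2 by auto
  moreover have "2 ^ r * (2 + S) = 2 * 2 ^ r + 2 ^ r * S" by (simp add: algebra_simps)
  moreover obtain k where k: "r = Suc (Suc k)" using r by (metis add_2_eq_Suc le_Suc_ex)
  moreover have "4 * S \<le> 2 ^ r * S" unfolding k by simp
  ultimately have le: "2 ^ r + 2 * S \<le> prod_list ds" by linarith
  have "E (prod_list ds) \<le> E (2 ^ r + 2 * S)" using le by (intro E_antimono) auto
  also have "\<dots> \<le> E (2 ^ r) * (1 / 2) ^ (2 * S)" by (intro E_decay) simp
  also have "(1 / 2 :: real) ^ (2 * S) = (1 / 4) ^ S" by (simp add: power_mult power_divide)
  also have "(1 / 4 :: real) ^ S = prod_list (map (\<lambda>d. (1 / 4) ^ (d - 2)) ds)"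
    unfolding S_def by (induction ds) (simp_all add: power_add)
  finally show ?thesis .
qed

text \<open>The decay weights are multiplicative along the tuple, so their sum over all tuples is
  the power \<open>r\<close> of a geometric sum and does not grow with \<open>card D\<close>. Every
  \<open>X\<close> is allowed because the terms are bounded in absolute value.\<close>

lemma sum_full_tuples_le:
  assumes r: "r \<ge> 2" and i: "i \<in> J" and X: "X \<subseteq> {ds. set ds \<subseteq> D \<and> length ds = r}"
  shows "\<bar>\<Sum>ds\<in>X. apply_all ds (V (prod_list ds)) i\<bar>
    \<le> E (2 ^ r) / 2 ^ r * (real (card J) ^ (r - 1) * (real (card D) + 1) ^ (r - 1))"
proof -
  let ?L = "{ds. set ds \<subseteq> D \<and> length ds = r}" and ?h = "\<lambda>d. (1 / 4 :: real) ^ (d - 2)"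
  let ?C = "real (card J) ^ (r - 1) / 2 ^ r * E (2 ^ r)"
  have C: "?C \<ge> 0" using E_nonneg[of "2 ^ r"] by simp
  have h0: "prod_list (map ?h ds) \<ge> 0" for ds by (induction ds) auto
  have each: "\<bar>apply_all ds (V (prod_list ds)) i\<bar> \<le> ?C * prod_list (map ?h ds)" if "ds \<in> ?L" for ds
  proof -
    have ds: "set ds \<subseteq> D" "length ds = r" using that by auto
    have p: "2 ^ r \<le> prod_list ds" using prod_list_ge_power[of ds] ds factor_ge_2 by auto
    have "\<bar>apply_all ds (V (prod_list ds)) i\<bar> \<le> real (card J) ^ (r - 1) / real (prod_list ds) * E (prod_list ds)"
      using ds r prod_list_pos by (intro abs_apply_all_V_le i) auto
    also have "\<dots> \<le> real (card J) ^ (r - 1) / 2 ^ r * (E (2 ^ r) * prod_list (map ?h ds))"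
    proof (rule mult_mono)
      have "2 ^ r \<le> real (prod_list ds)" using p by (metis of_nat_le_iff of_nat_numeral of_nat_power)
      then show "real (card J) ^ (r - 1) / real (prod_list ds) \<le> real (card J) ^ (r - 1) / 2 ^ r"
        using prod_list_pos[OF ds(1)] by (intro divide_left_mono mult_pos_pos) auto
    qed (use E_prod_list_le[OF ds r] E_nonneg prod_list_pos ds in auto)
    finally show ?thesis by (simp add: mult_ac)
  qed
  have "\<bar>\<Sum>ds\<in>X. apply_all ds (V (prod_list ds)) i\<bar> \<le> (\<Sum>ds\<in>X. \<bar>apply_all ds (V (prod_list ds)) i\<bar>)"
    by (rule sum_abs)
  also have "\<dots> \<le> (\<Sum>ds\<in>?L. ?C * prod_list (map ?h ds))"
  proof (rule order.trans[OF sum_mono[of X _ "\<lambda>ds. ?C * prod_list (map ?h ds)"]])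
    show "(\<Sum>ds\<in>X. ?C * prod_list (map ?h ds)) \<le> (\<Sum>ds\<in>?L. ?C * prod_list (map ?h ds))"
      by (intro sum_mono2 finite_tuples X mult_nonneg_nonneg[OF C h0])
  qed (use each X in auto)
  also have "\<dots> = ?C * (\<Sum>d\<in>D. ?h d) ^ r"
    by (simp only: sum_lists_prod_list[OF finite_factors] flip: sum_distrib_left)
  also have "\<dots> \<le> ?C * (real (card D) + 1) ^ (r - 1)"
  proof (rule mult_left_mono[OF _ C])
    \<comment> \<open>For empty \<open>D\<close> the left side is a positive power of 0. Otherwise
      \<open>card D + 1\<close> is at least 2, and it is enough to compare (4/3)^r with
      2^(r-1).\<close>
    show "(\<Sum>d\<in>D. ?h d) ^ r \<le> (real (card D) + 1) ^ (r - 1)"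
    proof (cases "D = {}")
      case True
      then show ?thesis using r by (simp add: power_0_left)
    next
      case False
      then have c: "real (card D) \<ge> 1" using finite_factors by (simp add: Suc_le_eq card_gt_0_iff)
      obtain k where k: "r = Suc (Suc k)" using r by (metis add_2_eq_Suc le_Suc_ex)
      have "(\<Sum>d\<in>D. ?h d) ^ r \<le> (4 / 3) ^ r"
        using sum_quarter_power_le[OF finite_factors factor_ge_2] by (intro power_mono sum_nonneg) auto
      also have "\<dots> = (4 / 3) ^ k * (16 / 9)" by (simp add: k)
      \<comment> \<open>Here r \<ge> 2 enters: two factors 4/3 together stay below one factor
        2.\<close>
      also have "\<dots> \<le> 2 ^ k * 2" by (intro mult_mono power_mono) auto
      also have "\<dots> \<le> (real (card D) + 1) ^ (r - 1)"
        using power_mono[of 2 "real (card D) + 1" "Suc k"] c by (simp add: k mult.commute)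
      finally show ?thesis .
    qed
  qed
  finally show ?thesis by (simp add: mult_ac)
qed

text \<open>Plain counting: length v < r leaves at most \<open>card D ^ v\<close> tuples, and the
  smaller power of \<open>card J\<close> is what produces the quotient by \<open>card J\<close> in
  the final bound.\<close>

lemma sum_boundary_tuples_le:
  assumes v: "1 \<le> v" "v \<le> r - 1" and i: "i \<in> J"
  shows "\<bar>\<Sum>ds\<in>boundary_tuples v (2 ^ r). apply_all ds (V (prod_list ds)) i\<bar>
    \<le> E (2 ^ r) / 2 ^ r * (real (card J) ^ (r - 2) * (real (card D) + 1) ^ (r - 1))"
proof -
  let ?C = "real (card J) ^ (r - 2) / 2 ^ r * E (2 ^ r)"
  have each: "\<bar>apply_all ds (V (prod_list ds)) i\<bar> \<le> ?C" if "ds \<in> boundary_tuples v (2 ^ r)" for ds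
  proof -
    have ds: "set ds \<subseteq> D" "length ds = Suc (v - 1)" and p: "2 ^ r < prod_list ds"
      using that v by (auto simp: boundary_tuples_def)
    have p': "2 ^ r \<le> real (prod_list ds)" using p by (metis of_nat_le_iff of_nat_numeral of_nat_power less_imp_le)
    have "\<bar>apply_all ds (V (prod_list ds)) i\<bar> \<le> real (card J) ^ (v - 1) / real (prod_list ds) * E (prod_list ds)"
      using ds prod_list_pos by (intro abs_apply_all_V_le i) auto
    also have "\<dots> \<le> ?C"
      using card_index_ge_1 v p p' E_nonneg[OF prod_list_pos[OF ds(1)]]
      by (intro mult_mono frac_le power_increasing E_antimono) auto
    finally show ?thesis .
  qed
  have C: "?C \<ge> 0" using E_nonneg[of "2 ^ r"] by simp
  have "card (boundary_tuples v (2 ^ r)) \<le> card {ds. set ds \<subseteq> D \<and> length ds = v}"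
    by (intro card_mono finite_tuples) (auto simp: boundary_tuples_def)
  also have "\<dots> = card D ^ v" by (rule card_lists_length_eq[OF finite_factors])
  finally have "real (card (boundary_tuples v (2 ^ r))) \<le> real (card D) ^ v"
    by (metis of_nat_le_iff of_nat_power)
  also have "\<dots> \<le> (real (card D) + 1) ^ v" by (intro power_mono) auto
  also have "\<dots> \<le> (real (card D) + 1) ^ (r - 1)" using v by (intro power_increasing) auto
  finally have card: "real (card (boundary_tuples v (2 ^ r))) \<le> (real (card D) + 1) ^ (r - 1)" .
  have "\<bar>\<Sum>ds\<in>boundary_tuples v (2 ^ r). apply_all ds (V (prod_list ds)) i\<bar>
      \<le> (\<Sum>ds\<in>boundary_tuples v (2 ^ r). \<bar>apply_all ds (V (prod_list ds)) i\<bar>)"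
    by (rule sum_abs)
  also have "\<dots> \<le> (\<Sum>ds\<in>boundary_tuples v (2 ^ r). ?C)" using each by (rule sum_mono)
  also have "\<dots> = real (card (boundary_tuples v (2 ^ r))) * ?C" by simp
  also have "\<dots> \<le> (real (card D) + 1) ^ (r - 1) * ?C"
    using card C by (rule mult_right_mono)
  finally show ?thesis by (simp add: mult_ac)
qed

lemma abs_remainder_le:
  assumes r: "r \<ge> 2" and i: "i \<in> J"
  shows "\<bar>V 1 i - (\<Sum>v\<le>r - 1. (- 1) ^ v * (\<Sum>ds\<in>short_tuples v (2 ^ r). apply_all ds (T (prod_list ds)) i))\<bar>
    \<le> 1 / 2 * (1 + (real r - 1) / real (card J))
      * (real (card J) * (real (card D) + 1) / 2) ^ (r - 1) * E (2 ^ r)"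
proof -
  define g where "g = real (card J)"
  define c where "c = real (card D) + 1"
  have g: "g \<ge> 1" unfolding g_def by (rule card_index_ge_1)
  obtain k where k: "r = Suc (Suc k)" using r by (metis add_2_eq_Suc le_Suc_ex)
  let ?W = "\<lambda>ds. apply_all ds (V (prod_list ds)) i"
  let ?R = "\<Sum>ds\<in>short_tuples r (2 ^ r) \<union> boundary_tuples r (2 ^ r). ?W ds"
  let ?Z = "\<lambda>v. \<Sum>ds\<in>boundary_tuples v (2 ^ r). ?W ds"
  have "\<bar>V 1 i - (\<Sum>v\<le>r - 1. (- 1) ^ v * (\<Sum>ds\<in>short_tuples v (2 ^ r). apply_all ds (T (prod_list ds)) i))\<bar>
      = \<bar>- ((- 1) ^ (r - 1)) * ?R + (\<Sum>v\<in>{1..r - 1}. (- 1) ^ v * ?Z v)\<bar>"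
    using iterated_recursion[OF i, of "2 ^ r" "r - 1"] r by simp
  also have "\<dots> \<le> \<bar>?R\<bar> + (\<Sum>v\<in>{1..r - 1}. \<bar>?Z v\<bar>)"
    by (rule order.trans[OF abs_triangle_ineq], rule add_mono)
      (auto simp: abs_mult power_abs intro!: order.trans[OF sum_abs])
  also have "\<dots> \<le> E (2 ^ r) / 2 ^ r * (g ^ (r - 1) * c ^ (r - 1))
      + (\<Sum>v\<in>{1..r - 1}. E (2 ^ r) / 2 ^ r * (g ^ (r - 2) * c ^ (r - 1)))"
    unfolding g_def c_def
    by (intro add_mono sum_mono sum_full_tuples_le sum_boundary_tuples_le r i)
      (auto simp: short_tuples_def boundary_tuples_def)
  \<comment> \<open>Of the \<open>r\<close> factors 1/2 one stays in front and the others join the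
    power \<open>r - 1\<close>; the shorter lengths contribute \<open>r - 1\<close> equal terms,
    each smaller by \<open>1 / g\<close>.\<close>
  also have "\<dots> = 1 / 2 * (1 + (real r - 1) / g) * (g * c / 2) ^ (r - 1) * E (2 ^ r)"
    using g by (simp add: k field_simps power_divide power_mult_distrib)
  finally show ?thesis unfolding g_def c_def .
qed

end

section \<open>The recursion for the vector \<open>V\<close>\<close>

context finite_comm_group
begin

lemma sum_lattice_classes_If:
  fixes F :: "'a set \<Rightarrow> real"
  shows "A0 \<in> lattice_classes G \<Longrightarrow> g \<in> A0 \<Longrightarrow> (\<Sum>A\<in>lattice_classes G. if g \<in> A then F A else 0) = F A0"
    and "g \<notin> carrier G \<Longrightarrow> (\<Sum>A\<in>lattice_classes G. if g \<in> A then F A else 0) = 0"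
proof -
  assume A0: "A0 \<in> lattice_classes G" "g \<in> A0"
  have "(\<Sum>A\<in>lattice_classes G. if g \<in> A then F A else 0)
      = (\<Sum>A\<in>lattice_classes G. if A0 = A then F A else 0)"
    using disjoint_lattice_classes[OF A0(1) _ A0(2)] A0(2) by (intro sum.cong refl) auto
  then show "(\<Sum>A\<in>lattice_classes G. if g \<in> A then F A else 0) = F A0"
    using A0 finite_lattice_classes by simp
next
  assume "g \<notin> carrier G"
  then show "(\<Sum>A\<in>lattice_classes G. if g \<in> A then F A else 0) = 0"
    using Union_lattice_classes by (intro sum.neutral) auto
qed

lemma norm_character_le_1:
  assumes "\<psi> \<in> annihilator G K" "g \<in> carrier G"
  shows "norm (\<psi> g) \<le> 1"
proof -
  have hom: "\<psi> \<in> hom G complex_units"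
    using assms(1) by (simp add: annihilator_def characters_def)
  have "\<psi> g ^ group.ord G g = \<psi> (g [^] group.ord G g)"
    using character_pow[OF hom assms(2)] by simp
  also have "\<dots> = 1"
    using complex_hom_one[OF subgroup_self, of \<psi>] hom assms(2) by simp
  finally have "norm (\<psi> g) ^ group.ord G g = 1" by (metis norm_one norm_power)
  then have "norm (\<psi> g) = 1"
    using ord_pos[OF assms(2)] power_eq_1_iff[of "norm (\<psi> g)" "group.ord G g"] by simp
  then show ?thesis by simp
qed

end

text \<open>The classes are disjoint, so each prime enters at most one of the entries, and a single
  zeta tail bounds all of them together.\<close>

lemma sum_V_vec_le:
  assumes q: "q > 1" and f: "real t * s > 1" and P: "P \<ge> 2"
  shows "(\<Sum>A\<in>lattice_classes (unit_group q). V_vec P q s t A) \<le> zeta_tail_bound P (real t * s)"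
proof -
  interpret finite_comm_group "unit_group q" using finite_comm_group_unit_group[OF q] .
  let ?f = "real t * s" and ?C = "lattice_classes (unit_group q)"
  have "(\<Sum>A\<in>?C. V_vec P q s t A)
      = (\<Sum>p. \<Sum>A\<in>?C. if int p mod int q \<in> A then prime_log P ?f p else 0)"
    unfolding V_vec_def ln_zeta_P_eq[OF f P]
    by (rule suminf_sum[symmetric]) (rule summable_prime_log_If[OF f P])
  also have "\<dots> \<le> suminf (prime_log P ?f)"
  proof (rule suminf_le)
    fix p
    show "(\<Sum>A\<in>?C. if int p mod int q \<in> A then prime_log P ?f p else 0) \<le> prime_log P ?f p"
    proof (cases "int p mod int q \<in> carrier (unit_group q)")
      case True
      then obtain A0 where "A0 \<in> ?C" "int p mod int q \<in> A0" using Union_lattice_classes by blast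
      then show ?thesis using sum_lattice_classes_If(1)[of A0 _ "\<lambda>_. prime_log P ?f p"] by simp
    next
      case False
      then show ?thesis
        using sum_lattice_classes_If(2)[of _ "\<lambda>_. prime_log P ?f p"] prime_log_nonneg[OF f P] by simp
    qed
  qed (auto intro!: summable_sum summable_prime_log_If summable_prime_log f P)
  also have "\<dots> \<le> zeta_tail_bound P ?f" by (rule suminf_prime_log_le[OF f P])
  finally show ?thesis .
qed

section \<open>Euler products over characters\<close>

definition L_factor :: "real \<Rightarrow> nat \<Rightarrow> real \<Rightarrow> (int \<Rightarrow> complex) \<Rightarrow> nat \<Rightarrow> complex" where
  "L_factor P q f \<psi> p =
     (if prime p \<and> P \<le> real p
      then inverse (1 - dirichlet_char q \<psi> p * of_real (real p powr (- f))) else 1)"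

text \<open>With x = p^(-f) \<le> 1/2, a factor differs from 1 by at most 2 x, which is dominated by
  twice the logarithmic series. Convergence is what permits exchanging the products over characters
  and over primes.\<close>

lemma convergent_prod_L_factor:
  assumes f: "f > 1" and P: "P \<ge> 2" and bound: "\<And>n. norm (dirichlet_char q \<psi> n) \<le> 1"
  shows "convergent_prod (L_factor P q f \<psi>)"
proof (intro abs_convergent_prod_imp_convergent_prod summable_imp_abs_convergent_prod)
  show "summable (\<lambda>p. norm (L_factor P q f \<psi> p - 1))"
  proof (rule summable_comparison_test'[OF summable_mult[OF summable_prime_log[OF f P], of 2], where N = 0])
    fix p :: nat
    show "norm (norm (L_factor P q f \<psi> p - 1)) \<le> 2 * prime_log P f p"
    proof (cases "prime p \<and> P \<le> real p")
      case True
      define x where "x = real p powr (- f)"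
      define c where "c = dirichlet_char q \<psi> p * of_real x"
      have x: "0 \<le> x" "x \<le> 1 / 2"
        using powr_minus_le_half[of "real p" f] True P f by (auto simp: x_def)
      have "norm c = norm (dirichlet_char q \<psi> p) * x" using x by (simp add: c_def norm_mult)
      also have "\<dots> \<le> 1 * x" using bound x by (intro mult_right_mono) auto
      finally have c: "norm c \<le> x" by simp
      have half: "1 / 2 \<le> norm (1 - c)"
        using norm_triangle_ineq2[of 1 c] c x by simp
      then have nz: "1 - c \<noteq> 0" by auto
      have "L_factor P q f \<psi> p - 1 = c / (1 - c)"
        using True nz by (simp add: L_factor_def c_def x_def field_simps)
      then have "norm (L_factor P q f \<psi> p - 1) = norm c / norm (1 - c)"
        by (simp add: norm_divide)
      also have "\<dots> \<le> x / (1 / 2)" using c half x by (intro frac_le) auto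
      also have "x \<le> - ln (1 - x)"
        using ln_le_minus_one[of "1 - x"] x by simp
      finally show ?thesis using True by (simp add: prime_log_def x_def)
    qed (auto simp: L_factor_def prime_log_def)
  qed
qed

text \<open>After the exchange of products, the factor at p depends only on the class of p modulo
  \<open>q\<close>. It contains x^m = p^(-m f), which is why \<open>V\<close> appears at
  \<open>m A * t\<close>; primes dividing \<open>q\<close> contribute 1.\<close>

lemma Gamma_vec_eq:
  fixes K :: "int set"
  assumes q: "q > 1" and f: "real t * s > 1" and P: "P \<ge> 2" and K: "subgroup K (unit_group q)"
  defines "G \<equiv> unit_group q"
  defines "m \<equiv> \<lambda>A. quot_order G (K <#>\<^bsub>G\<^esub> generate G A) K"
  shows "Gamma_vec P q s t K
    = (\<Sum>A\<in>lattice_classes G. real (quot_order G (carrier G) K) / real (m A) * V_vec P q s (m A * t) A)"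
proof -
  interpret finite_comm_group G unfolding G_def using finite_comm_group_unit_group[OF q] .
  note K = K[folded G_def]
  define N where "N = quot_order G (carrier G) K"
  let ?f = "real t * s" and ?C = "lattice_classes G"
  \<comment> \<open>\<open>m\<close> is defined through the generated subgroup, so any
    representative of the class computes it.\<close>
  have m_eq: "m A = relative_order G K g" if "A \<in> ?C" "g \<in> A" for A g
    using that generate_lattice_class[OF that] Union_lattice_classes quot_order_set_mult_generate[OF K, of g]
    by (auto simp: m_def)
  have m_pos: "m A > 0" if "A \<in> ?C" for A
    using ex_mem_lattice_class[OF that] m_eq[OF that] relative_order_pos[OF K] by auto
  have fm: "real (m A) * ?f > 1" if "A \<in> ?C" for A
  proof -
    have "1 * ?f \<le> real (m A) * ?f" using m_pos[OF that] f by (intro mult_right_mono) (auto simp: Suc_le_eq)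
    then show ?thesis using f by simp
  qed
  define h where "h p = (\<Sum>A\<in>?C. if int p mod int q \<in> A
      then real N / real (m A) * prime_log P (real (m A) * ?f) p else 0)" for p :: nat
  have summable: "summable (\<lambda>p. if int p mod int q \<in> A
      then real N / real (m A) * prime_log P (real (m A) * ?f) p else 0)" if "A \<in> ?C" for A
    using summable_mult[OF summable_prime_log_If[OF fm[OF that] P], of "real N / real (m A)"]
    by (simp add: if_distrib cong: if_cong)
  have bound: "norm (dirichlet_char q \<psi> n) \<le> 1" if "\<psi> \<in> annihilator G K" for \<psi> n
    using norm_character_le_1[OF that] mod_mem_unit_group_iff[OF q, of n]
    by (simp add: dirichlet_char_def G_def)
  have factor: "(\<Prod>\<psi>\<in>annihilator G K. L_factor P q ?f \<psi> p) = exp (of_real (h p))" for p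
  proof (cases "prime p \<and> P \<le> real p \<and> coprime p q")
    case True
    define g where "g = int p mod int q"
    define x where "x = real p powr (- ?f)"
    have g: "g \<in> carrier G" using True mod_mem_unit_group_iff[OF q] by (simp add: g_def G_def)
    then obtain A where A: "A \<in> ?C" "g \<in> A" using Union_lattice_classes by blast
    define k where "k = m A"
    have k: "k = relative_order G K g" unfolding k_def by (rule m_eq[OF A])
    have k0: "k > 0" unfolding k_def by (rule m_pos[OF A(1)])
    have x: "0 \<le> x" "x \<le> 1 / 2"
      using powr_minus_le_half[of "real p" ?f] True P f by (auto simp: x_def)
    have xk: "real p powr (- (real k * ?f)) = x ^ k"
      using True prime_gt_0_nat[of p] by (simp add: x_def powr_powr mult.commute flip: powr_realpow)
    have "x ^ k \<le> x ^ 1" using k0 x by (intro power_decreasing) auto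
    then have pos: "1 - x ^ k > 0" using x by simp
    have kN: "k dvd N" unfolding k N_def using prod_annihilator(1)[OF K g] .
    have "(\<Prod>\<psi>\<in>annihilator G K. L_factor P q ?f \<psi> p)
        = (\<Prod>\<psi>\<in>annihilator G K. inverse (1 - \<psi> g * of_real x))"
      using True by (simp add: L_factor_def dirichlet_char_def g_def x_def)
    also have "\<dots> = inverse (\<Prod>\<psi>\<in>annihilator G K. 1 - \<psi> g * of_real x)"
      by (simp add: prod_inversef[symmetric])
    also have "\<dots> = of_real (inverse ((1 - x ^ k) ^ (N div k)))"
      unfolding prod_annihilator(2)[OF K g] k[symmetric] N_def[symmetric] by simp
    also have "inverse ((1 - x ^ k) ^ (N div k)) = exp (real (N div k) * - ln (1 - x ^ k))"
      using pos by (simp add: exp_minus exp_of_nat_mult)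
    also have "real (N div k) * - ln (1 - x ^ k) = h p"
    proof -
      have "h p = real N / real k * prime_log P (real k * ?f) p"
        unfolding h_def g_def[symmetric] k_def
        by (rule sum_lattice_classes_If(1)[OF A])
      then show ?thesis using True xk kN by (simp add: prime_log_def real_of_nat_div)
    qed
    finally show ?thesis by (simp add: exp_of_real)
  next
    case False
    have "h p = 0"
    proof (cases "coprime p q")
      case True
      then show ?thesis using False by (auto simp: h_def prime_log_def intro!: sum.neutral)
    next
      case F: False
      then have "int p mod int q \<notin> carrier G" using mod_mem_unit_group_iff[OF q] by (simp add: G_def)
      then show ?thesis unfolding h_def by (rule sum_lattice_classes_If(2))
    qed
    moreover have "L_factor P q ?f \<psi> p = 1" for \<psi>
      using False by (auto simp: L_factor_def dirichlet_char_def)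
    ultimately show ?thesis by simp
  qed
  have sum_h: "summable h"
    unfolding h_def by (intro summable_sum summable)
  have "(\<Prod>\<psi>\<in>annihilator G K. L_P P q ?f \<psi>) = (\<Prod>\<psi>\<in>annihilator G K. \<Prod>p. L_factor P q ?f \<psi> p)"
    by (simp add: L_P_def L_factor_def)
  also have "\<dots> = (\<Prod>p. \<Prod>\<psi>\<in>annihilator G K. L_factor P q ?f \<psi> p)"
    using convergent_prod_L_factor[OF f P bound] by (intro prodinf_prod[symmetric])
  also have "\<dots> = (\<Prod>p. exp (of_real (h p)))" by (simp only: factor)
  also have "\<dots> = exp (\<Sum>p. of_real (h p))"
    using sum_h by (intro prodinf_exp) (simp add: summable_of_real_iff)
  \<comment> \<open>The product is the exponential of a real number, so \<open>Re\<close> loses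
    nothing and \<open>ln\<close> recovers the exponent.\<close>
  also have "\<dots> = of_real (exp (suminf h))"
    unfolding exp_of_real[symmetric] suminf_of_real[OF sum_h] ..
  finally have "Gamma_vec P q s t K = suminf h"
    by (simp add: Gamma_vec_def G_def)
  also have "\<dots> = (\<Sum>A\<in>?C. \<Sum>p. if int p mod int q \<in> A
      then real N / real (m A) * prime_log P (real (m A) * ?f) p else 0)"
    unfolding h_def by (rule suminf_sum[OF summable])
  also have "\<dots> = (\<Sum>A\<in>?C. real N / real (m A) * V_vec P q s (m A * t) A)"
  proof (rule sum.cong[OF refl])
    fix A assume A: "A \<in> ?C"
    have "(\<Sum>p. if int p mod int q \<in> A then real N / real (m A) * prime_log P (real (m A) * ?f) p else 0)
        = (\<Sum>p. real N / real (m A) * (if int p mod int q \<in> A then prime_log P (real (m A) * ?f) p else 0))"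
      by (intro suminf_cong) simp
    also have "\<dots> = real N / real (m A) * (\<Sum>p. if int p mod int q \<in> A then prime_log P (real (m A) * ?f) p else 0)"
      by (rule suminf_mult[OF summable_prime_log_If[OF fm[OF A] P]])
    also have "\<dots> = real N / real (m A) * V_vec P q s (m A * t) A"
      unfolding V_vec_def using ln_zeta_P_eq[OF fm[OF A] P] by (simp add: mult.assoc)
    finally show "(\<Sum>p. if int p mod int q \<in> A then real N / real (m A) * prime_log P (real (m A) * ?f) p else 0)
        = real N / real (m A) * V_vec P q s (m A * t) A" .
  qed
  finally show ?thesis unfolding N_def .
qed

text \<open>The weight in \<open>M1_inv\<close> cancels the index of \<open>K\<close> in
  \<open>G\<close> produced by \<open>Gamma_vec_eq\<close>. Sorting the pairs of a subgroup and a
  class by the index \<open>d\<close> then collects the Moebius values into the entries of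
  \<open>N_d\<close>.\<close>

lemma M1_inv_Gamma_vec_eq:
  assumes q: "q > 1" and f: "real t * s > 1" and P: "P \<ge> 2"
  defines "G \<equiv> unit_group q"
  assumes A0: "A0 \<in> lattice_classes G"
  shows "mat_vec (cyclic_subgroups G) (M1_inv q) (Gamma_vec P q s t) A0
    = (\<Sum>d | d dvd group_exp G.
        mat_vec (lattice_classes G) (\<lambda>A B. N_class q d A B / real d) (V_vec P q s (t * d)) A0)"
proof -
  interpret finite_comm_group G unfolding G_def using finite_comm_group_unit_group[OF q] .
  let ?C = "lattice_classes G" and ?D = "{d. d dvd group_exp G}"
  obtain a where a: "a \<in> A0" "a \<in> carrier G" using ex_mem_lattice_class[OF A0] by blast
  have B0: "generate G A0 = generate G {a}" by (rule generate_lattice_class[OF A0 a(1)])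
  define S where "S = {K. subgroup K G \<and> K \<subseteq> generate G {a}}"
  define \<mu> where "\<mu> K = real_of_int (moebius_mu (quot_order G (generate G {a}) K))" for K
  define m where "m K A = quot_order G (K <#>\<^bsub>G\<^esub> generate G A) K" for K A
  have finS: "finite S" unfolding S_def
    by (rule finite_subset[of _ "Pow (carrier G)"]) (use finite_carrier subgroup.subset in auto)
  have finD: "finite ?D" using group_exp_pos by simp
  \<comment> \<open>\<open>M1_inv\<close> is summed over cyclic subgroups, \<open>N_mat\<close> over
    all subgroups; inside a cyclic group these are the same.\<close>
  have Scyc: "S = {K \<in> cyclic_subgroups G. K \<subseteq> generate G {a}}"
    using subgroup_of_generate_cyclic[OF _ a(2)] by (auto simp: S_def cyclic_subgroups_def)
  have mD: "m K A \<in> ?D" if "K \<in> S" "A \<in> ?C" for K A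
  proof -
    obtain g where g: "g \<in> A" "g \<in> carrier G" using ex_mem_lattice_class[OF \<open>A \<in> ?C\<close>] by blast
    have K: "subgroup K G" using that by (simp add: S_def)
    show ?thesis
      using relative_order_dvd_group_exp[OF K g(2)] quot_order_set_mult_generate[OF K g(2)]
        generate_lattice_class[OF \<open>A \<in> ?C\<close> g(1)] by (simp add: m_def)
  qed
  have "mat_vec (cyclic_subgroups G) (M1_inv q) (Gamma_vec P q s t) A0
      = (\<Sum>K\<in>S. \<mu> K / real (quot_order G (carrier G) K) * Gamma_vec P q s t K)"
    unfolding mat_vec_def Scyc
    by (rule sum.mono_neutral_cong_right)
      (auto simp: finite_cyclic_subgroups M1_inv_def Let_def B0 \<mu>_def simp flip: G_def)
  also have "\<dots> = (\<Sum>K\<in>S. \<Sum>A\<in>?C. \<mu> K / real (m K A) * V_vec P q s (t * m K A) A)"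
  proof (rule sum.cong[OF refl])
    fix K assume "K \<in> S"
    then have K: "subgroup K G" by (simp add: S_def)
    have "quot_order G (carrier G) K > 0"
      using quot_order_pos[OF subgroup_self K subgroup.subset[OF K]] .
    then show "\<mu> K / real (quot_order G (carrier G) K) * Gamma_vec P q s t K
        = (\<Sum>A\<in>?C. \<mu> K / real (m K A) * V_vec P q s (t * m K A) A)"
      using Gamma_vec_eq[OF q f P, of K] K
      by (simp add: G_def m_def sum_distrib_left mult.commute)
  qed
  also have "\<dots> = (\<Sum>A\<in>?C. \<Sum>K\<in>S. \<mu> K / real (m K A) * V_vec P q s (t * m K A) A)"
    by (rule sum.swap)
  also have "\<dots> = (\<Sum>A\<in>?C. \<Sum>d\<in>?D. \<Sum>K\<in>{K \<in> S. m K A = d}. \<mu> K / real (m K A) * V_vec P q s (t * m K A) A)"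
    using mD by (intro sum.cong refl sum.group[symmetric] finS finD) auto
  also have "\<dots> = (\<Sum>A\<in>?C. \<Sum>d\<in>?D. N_class q d A0 A / real d * V_vec P q s (t * d) A)"
  proof (intro sum.cong refl)
    fix A d
    have "N_class q d A0 A = (\<Sum>K\<in>{K \<in> S. m K A = d}. \<mu> K)"
      by (simp add: N_class_def N_mat_def Let_def S_def m_def \<mu>_def B0 conj_assoc flip: G_def)
    then show "(\<Sum>K\<in>{K \<in> S. m K A = d}. \<mu> K / real (m K A) * V_vec P q s (t * m K A) A)
        = N_class q d A0 A / real d * V_vec P q s (t * d) A"
      by (simp add: sum_divide_distrib sum_distrib_right)
  qed
  also have "\<dots> = (\<Sum>d\<in>?D. mat_vec ?C (\<lambda>A B. N_class q d A B / real d) (V_vec P q s (t * d)) A0)"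
    unfolding mat_vec_def by (rule sum.swap)
  finally show ?thesis .
qed

lemma N_class_entries:
  assumes q: "q > 1"
  defines "G \<equiv> unit_group q"
  assumes A: "A \<in> lattice_classes G" and B: "B \<in> lattice_classes G"
  shows "\<bar>N_class q d A B\<bar> \<le> 1" and "N_class q 1 A B = (if A = B then 1 else 0)"
proof -
  interpret finite_comm_group G unfolding G_def using finite_comm_group_unit_group[OF q] .
  obtain a where a: "a \<in> A" "a \<in> carrier G" using ex_mem_lattice_class[OF A] by blast
  obtain b where b: "b \<in> B" "b \<in> carrier G" using ex_mem_lattice_class[OF B] by blast
  note ga = generate_lattice_class[OF A a(1)] and gb = generate_lattice_class[OF B b(1)]
  have N: "N_class q d A B = real_of_int (\<Sum>K | subgroup K G \<and> K \<subseteq> generate G {a} \<and>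
      quot_order G (K <#>\<^bsub>G\<^esub> generate G {b}) K = d. moebius_mu (quot_order G (generate G {a}) K))" for d
    by (simp add: N_class_def N_mat_def Let_def ga gb flip: G_def)
  show "\<bar>N_class q d A B\<bar> \<le> 1"
    using abs_sum_moebius_mu_subgroups_le[OF a(2) b(2), of d] unfolding N
    by (simp only: of_int_abs[symmetric] of_int_le_1_iff)
  show "N_class q 1 A B = (if A = B then 1 else 0)"
    unfolding N sum_moebius_mu_subgroups_1[OF a(2) b(2)]
    using generate_lattice_class_inj[OF A B] ga gb by simp
qed

text \<open>Enlarging the argument by \<open>v\<close> gains P^(-v) \<le> 2^(-v), while the bracket
  can only decrease.\<close>

lemma zeta_tail_bound_decay:
  assumes "u > 1" "P \<ge> 2" "v \<ge> 0" "real k \<le> v"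
  shows "zeta_tail_bound P (u + v) \<le> zeta_tail_bound P u * (1 / 2) ^ k"
proof -
  have "zeta_tail_bound P (u + v) = (1 + P / (u + v - 1)) / P powr u * P powr (- v)"
    using assms by (simp add: zeta_tail_bound_def powr_add powr_minus_divide)
  also have "\<dots> \<le> (1 + P / (u - 1)) / P powr u * (1 / 2) ^ k"
  proof (rule mult_mono)
    show "(1 + P / (u + v - 1)) / P powr u \<le> (1 + P / (u - 1)) / P powr u"
      using assms by (intro divide_right_mono add_left_mono frac_le) auto
    have "P powr (- v) \<le> P powr (- real k)" using assms by (intro powr_mono) auto
    also have "\<dots> \<le> 2 powr (- real k)" using assms by (intro powr_mono2') auto
    also have "\<dots> = (1 / 2) ^ k" by (simp add: powr_minus powr_realpow power_one_over inverse_eq_divide)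
    finally show "P powr (- v) \<le> (1 / 2) ^ k" .
  qed (use assms in auto)
  finally show ?thesis by (simp add: zeta_tail_bound_def)
qed

theorem theorem1p3:
  fixes q r :: nat and s P :: real
  assumes "q > 1" and "s > 1" and "P \<ge> 2" and "r \<ge> 2"
  defines "G \<equiv> unit_group q"
  shows "max_norm (lattice_classes G)
           (\<lambda>A. V_vec P q s 1 A -
                (\<Sum>v\<in>{0..r - 1}. (- 1) ^ v * (\<Sum>ds\<in>divisor_tuples q v (2 ^ r). term_vec P q s ds A)))
         \<le> 1 / 2 * (1 + (real r - 1) / real (card (lattice_classes G)))
           * (real (card (lattice_classes G)) * real (card {d. d dvd group_exp G}) / 2) ^ (r - 1)
           * ((1 + P / (s * 2 ^ r - 1)) / P powr (s * 2 ^ r))"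
proof -
  interpret finite_comm_group G unfolding G_def using finite_comm_group_unit_group[OF assms(1)] .
  let ?C = "lattice_classes G"
  define D where "D = {d. d dvd group_exp G \<and> d \<noteq> 1}"
  define M where "M d A B = N_class q d A B / real d" for d A B
  define T where "T t = mat_vec (cyclic_subgroups G) (M1_inv q) (Gamma_vec P q s t)" for t
  define E where "E t = zeta_tail_bound P (real t * s)" for t :: nat
  have ts: "real t * s > 1" if "t > 0" for t :: nat
  proof -
    have "1 * s \<le> real t * s" using that assms(2) by (intro mult_right_mono) auto
    then show ?thesis using assms(2) by linarith
  qed
  have fin: "finite {d. d dvd group_exp G}" using group_exp_pos by simp
  have divisors: "{d. d dvd group_exp G} = insert 1 D" by (auto simp: D_def)
  have notin: "1 \<notin> D" and finD: "finite D" using fin by (auto simp: D_def)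
  interpret bounded_matrix_recursion ?C D M "V_vec P q s" T E
  proof
    show "finite ?C" "?C \<noteq> {}" by (rule finite_lattice_classes lattice_classes_nonempty)+
    show "finite D" by (rule finD)
    show "d \<ge> 2" if "d \<in> D" for d
    proof -
      have "d dvd group_exp G" "d \<noteq> 1" using that by (auto simp: D_def)
      moreover have "d \<noteq> 0" using calculation(1) group_exp_pos by (metis dvd_0_left less_irrefl)
      ultimately show ?thesis by linarith
    qed
    show "V_vec P q s t A = T t A - (\<Sum>d\<in>D. mat_vec ?C (M d) (V_vec P q s (t * d)) A)"
      if "t > 0" "A \<in> ?C" for t A
    proof -
      \<comment> \<open>The divisor 1 reproduces \<open>V\<close> itself; moving the other divisors
        across gives the recursion, and it is also the one divisor missing from
        \<open>D\<close>.\<close>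
      have "mat_vec ?C (M 1) (V_vec P q s t) A = (\<Sum>B\<in>?C. if A = B then V_vec P q s t B else 0)"
        unfolding mat_vec_def M_def using N_class_entries(2)[OF assms(1)] that(2)
        by (intro sum.cong refl) (simp add: G_def)
      also have "\<dots> = V_vec P q s t A" using that(2) finite_lattice_classes by simp
      finally have one: "mat_vec ?C (M 1) (V_vec P q s t) A = V_vec P q s t A" .
      have "T t A = (\<Sum>d\<in>insert 1 D. mat_vec ?C (M d) (V_vec P q s (t * d)) A)"
        using M1_inv_Gamma_vec_eq[OF assms(1) ts[OF that(1)] assms(3)] that(2)
        unfolding T_def M_def divisors[symmetric] G_def by simp
      then show ?thesis using one notin finD by simp
    qed
    show "\<bar>M d A B\<bar> \<le> 1 / real d" if "A \<in> ?C" "B \<in> ?C" for d A B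
      using N_class_entries(1)[OF assms(1), of A B d] that
      by (simp add: M_def G_def divide_right_mono)
    show "V_vec P q s t A \<ge> 0" if "t > 0" for t A
      using V_vec_nonneg[OF ts[OF that] assms(3)] .
    show "(\<Sum>A\<in>?C. V_vec P q s t A) \<le> E t" if "t > 0" for t
      unfolding E_def G_def using sum_V_vec_le[OF assms(1) ts[OF that] assms(3)] .
    show "E (t + k) \<le> E t * (1 / 2) ^ k" if "t > 0" for t k
    proof -
      \<comment> \<open>Adding \<open>k\<close> to the index raises the argument by
        \<open>k * s\<close>, which is at least \<open>k\<close>.\<close>
      have "real k * 1 \<le> real k * s" using assms(2) by (intro mult_left_mono) auto
      then show ?thesis
        using zeta_tail_bound_decay[OF ts[OF that] assms(3), of "real k * s" k] assms(2)
        by (simp add: E_def distrib_right)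
    qed
  qed
  have tuples: "divisor_tuples q v b = short_tuples v b" for v b
    unfolding divisor_tuples_def short_tuples_def by (auto simp: D_def G_def)
  have terms: "term_vec P q s ds = apply_all ds (T (prod_list ds))" for ds
    unfolding term_vec_def apply_all_def unfolding T_def M_def[abs_def] G_def ..
  have card: "real (card {d. d dvd group_exp G}) = real (card D) + 1"
    unfolding divisors using notin finD by simp
  have E: "E (2 ^ r) = (1 + P / (s * 2 ^ r - 1)) / P powr (s * 2 ^ r)"
    by (simp add: E_def zeta_tail_bound_def mult.commute)
  show ?thesis
    unfolding max_norm_def
  proof (rule Max.boundedI)
    fix x assume "x \<in> (\<lambda>A. \<bar>V_vec P q s 1 A -
        (\<Sum>v\<in>{0..r - 1}. (- 1) ^ v * (\<Sum>ds\<in>divisor_tuples q v (2 ^ r). term_vec P q s ds A))\<bar>) ` ?C"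
    then obtain A where "A \<in> ?C" "x = \<bar>V_vec P q s 1 A -
        (\<Sum>v\<in>{0..r - 1}. (- 1) ^ v * (\<Sum>ds\<in>divisor_tuples q v (2 ^ r). term_vec P q s ds A))\<bar>" by blast
    then show "x \<le> 1 / 2 * (1 + (real r - 1) / real (card ?C))
        * (real (card ?C) * real (card {d. d dvd group_exp G}) / 2) ^ (r - 1)
        * ((1 + P / (s * 2 ^ r - 1)) / P powr (s * 2 ^ r))"
      using abs_remainder_le[OF assms(4)] unfolding tuples terms card E by (simp add: atLeast0AtMost)
  qed (use finite_lattice_classes lattice_classes_nonempty in auto)
qed

end
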